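(* Let $G$ be a $2k$-regular, $2k$-edge connected graph with $n\ge 2$ vertices. Then $\mathsf M(G)\ge (k!)^{n-3}$. Moreover, equality holds if and only if $G$ is totally decomposable.
   Context: Graphs are finite and undirected, and may have multiple edges and self-loops. A graph is $2k$-regular if every vertex has degree $2k$, where a self-loop counts $2$. $2k$-edge connected means every edge cut has at least $2k$ edges. Transitions. Let $v$ be a vertex without self-loops, with incident edges $e_i=vw_i$. A transition at $v$ is a partition $\tau$ of the $2k$ edges at $v$ into pairs; $\mathcal T(v)$ is the set of transitions at $v$. The graph $G_\tau$ deletes $v$ and its incident edges and adds an edge $w_iw_j$ for each pair $\{e_i,e_j\}\in\tau$. Martin invariant. For a $2k$-regular graph with at least 3 vertices, $\mathsf M(G)$ is defined recursively: - $\mathsf M(G)=0$ if $G$ has a self-loop; - $\mathsf M(G)=1$ if $G$ has exactly 3 vertices and no self-loop; - otherwise $\mathsf M(G)=\sum_{\tau\in\mathcal T(v)}\mathsf M(G_\tau)$ for any vertex $v$; this is independent of $v$. For the two-vertex graph $K_2^{[2k]}$ (two vertices joined by $2k$ parallel edges), the paper's general definition gives $\mathsf M(K_2^{[2k]})=1/k!$. Decompositions. Let $G$ be a $2k$-edge connected $2k$-regular graph with at least 3 vertices. Suppose $C$ is an edge cut of size $2k$ whose vertex bipartition $X\sqcup Y$ has $|X|,|Y|\ge 2$. This cut yields two graphs: - $G_X$, obtained from the subgraph induced on $X$ by adding one new vertex joined, by the edges of $C$, to their endpoints in $X$; - $G_Y$, defined similarly. Repeatedly performing such replacements on the resulting graphs,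 until no graph has such a non-trivial $2k$-edge cut, gives a list $G_1,\dots,G_p$, called a decomposition of $G$. The graph $G$ is totally decomposable if it has a decomposition in which every $G_i$ has exactly $3$ vertices.
   Formalization: Total decomposability is defined only for graphs with at least 3 vertices, so the equality criterion is undefined for n = 2; here a two-vertex graph is counted as totally decomposable by convention, in accordance with M = 1/k! = (k!)^{n-3} there. *)

theory Defs
  imports Complex_Main "HOL-Library.Disjoint_Sets"
begin

text \<open>
  A finite undirected graph, possibly with multiple edges and self-loops, is given by its
  half-edges: an edge is a two-element set of half-edges, distinct edges are disjoint, and
  \<open>vert G h\<close> is the vertex at which the half-edge \<open>h\<close> is attached.  Parallel edges are thus
  distinguishable, and an edge is a self-loop if both of its halves are attached to the same
  vertex.  The values of \<open>vert G\<close> outside of \<open>\<Union>(edges G)\<close> are irrelevant.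
\<close>

record ('v, 'h) graph =
  verts :: "'v set"
  edges :: "'h set set"
  vert :: "'h \<Rightarrow> 'v"

definition multigraph :: "('v, 'h) graph \<Rightarrow> bool" where
  "multigraph G \<longleftrightarrow> finite (verts G) \<and> finite (edges G) \<and>
     (\<forall>e\<in>edges G. card e = 2) \<and> disjoint (edges G) \<and> vert G ` \<Union>(edges G) \<subseteq> verts G"

text \<open>A self-loop contributes two half-edges to the degree.\<close>

definition degree :: "('v, 'h) graph \<Rightarrow> 'v \<Rightarrow> nat" where
  "degree G v = card {h \<in> \<Union>(edges G). vert G h = v}"

definition regular :: "nat \<Rightarrow> ('v, 'h) graph \<Rightarrow> bool" where
  "regular d G \<longleftrightarrow> (\<forall>v\<in>verts G. degree G v = d)"

definition has_self_loop :: "('v, 'h) graph \<Rightarrow> bool" where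
  "has_self_loop G \<longleftrightarrow> (\<exists>e\<in>edges G. \<exists>v. vert G ` e = {v})"

definition edge_cut :: "('v, 'h) graph \<Rightarrow> 'v set \<Rightarrow> 'v set \<Rightarrow> 'h set set" where
  "edge_cut G X Y = {e \<in> edges G. vert G ` e \<inter> X \<noteq> {} \<and> vert G ` e \<inter> Y \<noteq> {}}"

definition bipartition :: "('v, 'h) graph \<Rightarrow> 'v set \<Rightarrow> 'v set \<Rightarrow> bool" where
  "bipartition G X Y \<longleftrightarrow> X \<union> Y = verts G \<and> X \<inter> Y = {} \<and> X \<noteq> {} \<and> Y \<noteq> {}"

definition edge_connected :: "nat \<Rightarrow> ('v, 'h) graph \<Rightarrow> bool" where
  "edge_connected m G \<longleftrightarrow> (\<forall>X Y. bipartition G X Y \<longrightarrow> m \<le> card (edge_cut G X Y))"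

subsection \<open>Transitions and the Martin invariant\<close>

definition incident :: "('v, 'h) graph \<Rightarrow> 'v \<Rightarrow> 'h set set" where
  "incident G v = {e \<in> edges G. v \<in> vert G ` e}"

definition transitions :: "('v, 'h) graph \<Rightarrow> 'v \<Rightarrow> 'h set set set set" where
  "transitions G v = {\<tau>. partition_on (incident G v) \<tau> \<and> (\<forall>p\<in>\<tau>. card p = 2)}"

text \<open>
  If the pair \<open>p\<close> consists of the edges \<open>vw\<close> and \<open>vw'\<close>, then the two half-edges of \<open>\<Union>p\<close> that
  are not attached to \<open>v\<close> are those at \<open>w\<close> and \<open>w'\<close>; together they form the new edge \<open>ww'\<close>.
\<close>

definition resolve :: "('v, 'h) graph \<Rightarrow> 'v \<Rightarrow> 'h set set set \<Rightarrow> ('v, 'h) graph" where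
  "resolve G v \<tau> =
     \<lparr> verts = verts G - {v},
       edges = (edges G - incident G v) \<union> (\<lambda>p. {h \<in> \<Union>p. vert G h \<noteq> v}) ` \<tau>,
       vert = vert G \<rparr>"

text \<open>
  The vertex \<open>v\<close> that is expanded is an arbitrary one; for regular graphs of even degree, the
  value does not depend on it.  A two-vertex \<open>2k\<close>-regular graph without self-loops consists of
  \<open>2k\<close> parallel edges, so that its value is \<open>1/k!\<close>.  The value \<open>0\<close> for loop-free graphs
  with fewer than two (or infinitely many) vertices is a dummy.
\<close>

function martin :: "('v, 'h) graph \<Rightarrow> real" where
  "martin G =
     (if has_self_loop G then 0
      else if card (verts G) < 2 then 0
      else if card (verts G) = 2 then 1 / fact (card (edges G) div 2)
      else if card (verts G) = 3 then 1
      else let v = (SOME v. v \<in> verts G)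
           in \<Sum>\<tau>\<in>transitions G v. martin (resolve G v \<tau>))"
  by auto
termination
proof (relation "measure (\<lambda>G. card (verts G))", goal_cases)
  case 1
  show ?case by simp
next
  case (2 G v \<tau>)
  then have "finite (verts G)" "verts G \<noteq> {}"
    by (auto intro: card_ge_0_finite)
  moreover from this 2 have "v \<in> verts G"
    by (simp add: some_in_eq)
  ultimately show ?case
    by (simp add: resolve_def card_gt_0_iff)
qed

declare martin.simps [simp del]

subsection \<open>Decompositions\<close>

text \<open>
  The subgraph induced on \<open>X\<close> together with one additional vertex \<open>z\<close>, to which the edges
  leaving \<open>X\<close> are reattached.  The vertex \<open>z\<close> only has to lie outside of \<open>X\<close>; below, a vertex
  from the other side of the cut is reused as its name.
\<close>

definition cut_side :: "('v, 'h) graph \<Rightarrow> 'v set \<Rightarrow> 'v \<Rightarrow> ('v, 'h) graph" where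
  "cut_side G X z =
     \<lparr> verts = insert z X,
       edges = {e \<in> edges G. vert G ` e \<subseteq> X} \<union> edge_cut G X (verts G - X),
       vert = (\<lambda>h. if vert G h \<in> X then vert G h else z) \<rparr>"

definition nontrivial_cut :: "nat \<Rightarrow> ('v, 'h) graph \<Rightarrow> 'v set \<Rightarrow> 'v set \<Rightarrow> bool" where
  "nontrivial_cut k G X Y \<longleftrightarrow>
     bipartition G X Y \<and> 2 \<le> card X \<and> 2 \<le> card Y \<and> card (edge_cut G X Y) = 2 * k"

inductive decomposition :: "nat \<Rightarrow> ('v, 'h) graph \<Rightarrow> ('v, 'h) graph list \<Rightarrow> bool"
  for k :: nat where
  stop: "(\<nexists>X Y. nontrivial_cut k G X Y) \<Longrightarrow> decomposition k G [G]"
| split: "nontrivial_cut k G X Y \<Longrightarrow> x \<in> X \<Longrightarrow> y \<in> Y \<Longrightarrow>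
     decomposition k (cut_side G X y) Gs \<Longrightarrow> decomposition k (cut_side G Y x) Hs \<Longrightarrow>
     decomposition k G (Gs @ Hs)"

text \<open>
  Decompositions are of interest for graphs with at least three vertices.  By convention, the
  two-vertex graph of \<open>2k\<close> parallel edges counts as totally decomposable: gluing with it does
  not change a graph, so that it is the empty product.
\<close>

definition totally_decomposable :: "nat \<Rightarrow> ('v, 'h) graph \<Rightarrow> bool" where
  "totally_decomposable k G \<longleftrightarrow>
     card (verts G) = 2 \<or>
     (\<exists>Gs. decomposition k G Gs \<and> (\<forall>H\<in>set Gs. card (verts H) = 3))"

end

theory Submission
  imports Defs
begin

text \<open>
  Call a transition at \<open>v\<close> good if resolving it keeps the graph \<open>2k\<close>-edge connected.  Bad
  transitions contribute nothing to the Martin invariant, because a small cut persists until one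
  of its sides is a single vertex, which then carries a loop.  By Lovasz' splitting-off argument,
  an edge at a vertex with \<open>2j\<close> remaining edges has at least \<open>j\<close> admissible partners, so there are
  at least \<open>k!\<close> good transitions, and the bound follows by induction.  If no non-trivial tight cut
  exists, the first edge has at least \<open>k + 1\<close> admissible partners and the inequality is strict.

  For the equality case neither the product formula for \<open>2k\<close>-edge cuts nor the independence of the
  expanded vertex is needed: a graph with at least four vertices is totally decomposable iff, at any
  given vertex, there are exactly \<open>k!\<close> good transitions and all of them lead to totally decomposable
  graphs.  This rests on the fact that, for a tight cut and a vertex \<open>v\<close> in \<open>X\<close>, the good
  transitions at \<open>v\<close> are the same in \<open>G\<close> and in \<open>G\<^sub>X\<close>, and resolving them commutes with
  splitting along the cut.
\<close>

section \<open>Cut sizes\<close>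

text \<open>One expansion multiplies two bounds: at least \<open>fact k\<close> terms survive, and
  each is at least the bound for one vertex fewer. Equality means that both are attained at the
  vertex which the recursion happens to choose. Total decomposability, in contrast, asks for some
  cut, which has nothing to do with that vertex. But every vertex lies on one side of every cut, so
  the two can be compared cut by cut, and as the condition on transitions mentions no cut, all cuts
  give the same answer.

  The comparison rests on one observation. If \<open>v\<close> lies in \<open>X\<close> and the cut
  is tight, a good transition never pairs two edges from \<open>v\<close> to \<open>Y\<close>, since
  this would push the cut below 2k. Hence no cut inside \<open>Y\<close> changes, and the transition
  acts on the \<open>X\<close> side alone. The constant \<open>fact k\<close> is attained at the
  bottom, where \<open>X = {v, u}\<close>: there the good transitions are perfect matchings between
  k edges to \<open>u\<close> and k edges to \<open>Y\<close>.\<close>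

definition crossing :: "('v, 'h) graph \<Rightarrow> 'v set \<Rightarrow> 'h set \<Rightarrow> bool" where
  "crossing G S e \<longleftrightarrow> vert G ` e \<inter> S \<noteq> {} \<and> \<not> vert G ` e \<subseteq> S"

text \<open>Neither this nor \<open>crossing\<close> refers to \<open>verts G\<close>, so deleting
  \<open>v\<close> from the vertex set alone leaves all cut sizes unchanged.\<close>

definition cutsize :: "('v, 'h) graph \<Rightarrow> 'v set \<Rightarrow> nat" where
  "cutsize G S = card {e \<in> edges G. crossing G S e}"

lemma multigraph_edge:
  assumes "multigraph G" "e \<in> edges G"
  obtains h h' where "e = {h, h'}" "h \<noteq> h'" "vert G h \<in> verts G" "vert G h' \<in> verts G"
proof -
  have "card e = 2" "vert G ` e \<subseteq> verts G"
    using assms by (auto simp: multigraph_def)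
  then show thesis
    using that by (auto simp: card_2_iff)
qed

lemma multigraph_finite: "multigraph G \<Longrightarrow> finite (edges G)" "multigraph G \<Longrightarrow> finite (verts G)"
  by (auto simp: multigraph_def)

lemma multigraph_unique_edge:
  "multigraph G \<Longrightarrow> e \<in> edges G \<Longrightarrow> f \<in> edges G \<Longrightarrow> h \<in> e \<Longrightarrow> h \<in> f \<Longrightarrow> e = f"
  unfolding multigraph_def disjoint_def by blast

lemma cutsize_sum:
  assumes "finite (edges G)"
  shows "cutsize G S = (\<Sum>e\<in>edges G. of_bool (crossing G S e))"
  using assms by (simp add: cutsize_def Int_def)

lemma cutsize_eq_edge_cut:
  assumes "multigraph G" "bipartition G X Y"
  shows "card (edge_cut G X Y) = cutsize G X"
proof -
  have "edge_cut G X Y = {e \<in> edges G. crossing G X e}"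
    using assms unfolding edge_cut_def crossing_def bipartition_def multigraph_def
    by blast
  then show ?thesis by (simp add: cutsize_def)
qed

lemma cutsize_Diff:
  assumes "multigraph G" "S \<subseteq> verts G"
  shows "cutsize G (verts G - S) = cutsize G S"
proof -
  have "crossing G (verts G - S) e \<longleftrightarrow> crossing G S e" if e: "e \<in> edges G" for e
    using assms(1) e
  proof (rule multigraph_edge)
  qed (use assms(2) in \<open>auto simp: crossing_def\<close>)
  then show ?thesis by (auto simp: cutsize_def intro!: arg_cong[where f = card])
qed

lemma cutsize_submod:
  assumes "multigraph G"
  shows "cutsize G (A \<inter> B) + cutsize G (A \<union> B) \<le> cutsize G A + cutsize G B"
proof -
  have "of_bool (crossing G (A \<inter> B) e) + of_bool (crossing G (A \<union> B) e)
      \<le> of_bool (crossing G A e) + (of_bool (crossing G B e) :: nat)" if e: "e \<in> edges G" for e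
    using assms e by (rule multigraph_edge) (auto simp: crossing_def)
  then have "(\<Sum>e\<in>edges G. of_bool (crossing G (A \<inter> B) e) + of_bool (crossing G (A \<union> B) e))
      \<le> (\<Sum>e\<in>edges G. of_bool (crossing G A e) + (of_bool (crossing G B e) :: nat))"
    by (rule sum_mono)
  then show ?thesis
    using assms by (simp add: cutsize_sum multigraph_finite sum.distrib)
qed

text \<open>The gain of 2 comes from \<open>e\<^sub>0\<close>: an edge from
  \<open>A \<inter> B\<close> to the outside of \<open>A \<union> B\<close> crosses both
  \<open>A\<close> and \<open>B\<close> but neither difference.\<close>

lemma cutsize_posimod_strict:
  assumes "multigraph G" "e\<^sub>0 \<in> edges G" "vert G ` e\<^sub>0 \<inter> (A \<inter> B) \<noteq> {}" "\<not> vert G ` e\<^sub>0 \<subseteq> A \<union> B"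
  shows "cutsize G (A - B) + cutsize G (B - A) + 2 \<le> cutsize G A + cutsize G B"
proof -
  have *: "of_bool (crossing G (A - B) e) + of_bool (crossing G (B - A) e) + (if e = e\<^sub>0 then 2 else 0)
      \<le> of_bool (crossing G A e) + (of_bool (crossing G B e) :: nat)" if e: "e \<in> edges G" for e
    using assms(1) e by (rule multigraph_edge) (use assms(3,4) in \<open>auto simp: crossing_def\<close>)
  have "(\<Sum>e\<in>edges G. of_bool (crossing G (A - B) e) + of_bool (crossing G (B - A) e)
      + (if e = e\<^sub>0 then 2 else 0))
    \<le> (\<Sum>e\<in>edges G. of_bool (crossing G A e) + (of_bool (crossing G B e) :: nat))"
    by (rule sum_mono) (rule *)
  then show ?thesis
    using assms(1,2) by (simp add: cutsize_sum multigraph_finite sum.distrib)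
qed

lemma cutsize_Un_disjoint:
  assumes "multigraph G" "A \<inter> B = {}"
  shows "cutsize G A + cutsize G B =
    cutsize G (A \<union> B) + 2 * card {e \<in> edges G. vert G ` e \<inter> A \<noteq> {} \<and> vert G ` e \<inter> B \<noteq> {}}"
proof -
  have "of_bool (crossing G A e) + of_bool (crossing G B e) = of_bool (crossing G (A \<union> B) e)
      + 2 * (of_bool (vert G ` e \<inter> A \<noteq> {} \<and> vert G ` e \<inter> B \<noteq> {}) :: nat)" if e: "e \<in> edges G" for e
    using assms(1) e by (rule multigraph_edge) (use assms(2) in \<open>auto simp: crossing_def\<close>)
  then have "(\<Sum>e\<in>edges G. of_bool (crossing G A e) + of_bool (crossing G B e)) =
     (\<Sum>e\<in>edges G. of_bool (crossing G (A \<union> B) e)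
      + 2 * (of_bool (vert G ` e \<inter> A \<noteq> {} \<and> vert G ` e \<inter> B \<noteq> {}) :: nat))"
    by (intro sum.cong) auto
  then show ?thesis
    using multigraph_finite(1)[OF assms(1)]
    by (simp add: cutsize_sum sum.distrib Int_def flip: sum_distrib_left)
qed

lemma degree_cutsize:
  assumes "multigraph G"
  shows "degree G v = cutsize G {v} + 2 * card {e \<in> edges G. vert G ` e = {v}}"
proof -
  have fin: "finite e" if "e \<in> edges G" for e
    using assms that by (auto simp: multigraph_def intro: card_ge_0_finite)
  have *: "card {h \<in> e. vert G h = v} = of_bool (crossing G {v} e) + 2 * of_bool (vert G ` e = {v})"
    if e: "e \<in> edges G" for e
    using assms e
  proof (rule multigraph_edge)
    fix h h' assume e: "e = {h, h'}" "h \<noteq> h'"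
    have "{x \<in> e. vert G x = v} = (if vert G h = v then {h} else {}) \<union> (if vert G h' = v then {h'} else {})"
      by (auto simp: e)
    with e show ?thesis by (auto simp: crossing_def)
  qed
  have "{h \<in> \<Union>(edges G). vert G h = v} = (\<Union>e\<in>edges G. {h \<in> e. vert G h = v})"
    by blast
  then have "degree G v = (\<Sum>e\<in>edges G. card {h \<in> e. vert G h = v})"
    unfolding degree_def
  proof (simp only:, intro card_UN_disjoint)
    show "\<forall>i\<in>edges G. \<forall>j\<in>edges G. i \<noteq> j \<longrightarrow> {h \<in> i. vert G h = v} \<inter> {h \<in> j. vert G h = v} = {}"
      using assms by (auto simp: multigraph_def disjoint_def)
  qed (use assms fin in \<open>auto simp: multigraph_finite\<close>)
  also have "\<dots> = (\<Sum>e\<in>edges G. of_bool (crossing G {v} e) + 2 * of_bool (vert G ` e = {v}))"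
    by (intro sum.cong) (auto simp: *)
  also have "\<dots> = cutsize G {v} + 2 * card {e \<in> edges G. vert G ` e = {v}}"
    using multigraph_finite(1)[OF assms]
    by (simp add: cutsize_sum sum.distrib Int_def flip: sum_distrib_left)
  finally show ?thesis .
qed

text \<open>Adding a vertex changes the cut size by its degree modulo 2, because loops and edges to
  the earlier vertices are counted twice.\<close>

lemma even_cutsize:
  assumes "multigraph G" "finite S" "\<And>v. v \<in> S \<Longrightarrow> even (degree G v)"
  shows "even (cutsize G S)"
  using assms(2,3)
proof (induction S)
  case empty
  then show ?case by (simp add: cutsize_def crossing_def)
next
  case (insert v S)
  have "even (cutsize G {v})"
    using insert.prems[of v] degree_cutsize[OF assms(1), of v] by simp
  moreover have "even (cutsize G S)"
    using insert by simp
  ultimately have "even (cutsize G S + cutsize G {v})"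
    by simp
  also have "cutsize G S + cutsize G {v} = cutsize G (insert v S)
    + 2 * card {e \<in> edges G. vert G ` e \<inter> S \<noteq> {} \<and> vert G ` e \<inter> {v} \<noteq> {}}"
    using cutsize_Un_disjoint[OF assms(1), of S "{v}"] insert.hyps by simp
  finally show ?case by simp
qed

section \<open>Splitting off pairs of edges at a vertex\<close>

definition new_edge :: "('v, 'h) graph \<Rightarrow> 'v \<Rightarrow> 'h set set \<Rightarrow> 'h set" where
  "new_edge G v p = {h \<in> \<Union>p. vert G h \<noteq> v}"

text \<open>Unlike \<open>resolve\<close>, this keeps \<open>v\<close> and accepts an incomplete set
  of pairs, so that a transition can be carried out pair by pair.\<close>

definition split_off :: "('v, 'h) graph \<Rightarrow> 'v \<Rightarrow> 'h set set set \<Rightarrow> ('v, 'h) graph" where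
  "split_off G v P = G\<lparr>edges := (edges G - \<Union>P) \<union> new_edge G v ` P\<rparr>"

definition loop_free_at :: "('v, 'h) graph \<Rightarrow> 'v \<Rightarrow> bool" where
  "loop_free_at G v \<longleftrightarrow> (\<forall>e\<in>edges G. vert G ` e \<noteq> {v})"

definition pairing :: "('v, 'h) graph \<Rightarrow> 'v \<Rightarrow> 'h set set set \<Rightarrow> bool" where
  "pairing G v P \<longleftrightarrow> disjoint P \<and> \<Union>P \<subseteq> incident G v \<and> (\<forall>p\<in>P. card p = 2)"

lemma incident_edge:
  assumes "multigraph G" "loop_free_at G v" "e \<in> incident G v"
  obtains h h' where "e = {h, h'}" "h \<noteq> h'" "vert G h = v" "vert G h' \<noteq> v" "vert G h' \<in> verts G"
proof -
  have e: "e \<in> edges G" "v \<in> vert G ` e" using assms(3) by (auto simp: incident_def)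
  from assms(1) e(1) show thesis
  proof (rule multigraph_edge)
    fix h h' assume h: "e = {h, h'}" "h \<noteq> h'" "vert G h \<in> verts G" "vert G h' \<in> verts G"
    have "vert G h \<noteq> vert G h'"
      using assms(2) e h(1) unfolding loop_free_at_def by fastforce
    then show thesis
      using that[of h h'] that[of h' h] e(2) h by (auto simp: insert_commute)
  qed
qed

text \<open>\<open>a\<close> and \<open>b\<close> belong to disjoint edges, so they differ even if
  \<open>e\<close> and \<open>f\<close> are parallel; the new edge may be a loop but still has two
  half-edges.\<close>

lemma new_edge_pair:
  assumes "multigraph G" "loop_free_at G v" "pairing G v P" "p \<in> P"
  obtains e f a b where "p = {e, f}" "e \<noteq> f" "e \<in> incident G v" "f \<in> incident G v"
    "new_edge G v p = {a, b}" "a \<noteq> b" "a \<in> e" "b \<in> f"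
    "vert G ` e = {v, vert G a}" "vert G ` f = {v, vert G b}" "vert G a \<noteq> v" "vert G b \<noteq> v"
    "vert G a \<in> verts G" "vert G b \<in> verts G"
proof -
  have "card p = 2" "p \<subseteq> incident G v" using assms(3,4) by (auto simp: pairing_def)
  then obtain e f where p: "p = {e, f}" "e \<noteq> f" "e \<in> incident G v" "f \<in> incident G v"
    by (auto simp: card_2_iff)
  obtain h a where e: "e = {h, a}" "h \<noteq> a" "vert G h = v" "vert G a \<noteq> v" "vert G a \<in> verts G"
    using incident_edge[OF assms(1,2) p(3)] .
  obtain h' b where f: "f = {h', b}" "h' \<noteq> b" "vert G h' = v" "vert G b \<noteq> v" "vert G b \<in> verts G"
    using incident_edge[OF assms(1,2) p(4)] .
  have "e \<inter> f = {}"
    using assms(1) p by (auto simp: multigraph_def disjoint_def incident_def)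
  then have "a \<noteq> b" using e f by auto
  moreover have "new_edge G v p = {a, b}"
    using e f p by (auto simp: new_edge_def)
  ultimately show thesis
    using that[OF p, of a b] e f by auto
qed

text \<open>A half-edge of the new edge determines the old edge containing it, and that edge
  determines its pair.\<close>

lemma inj_on_new_edge:
  assumes "multigraph G" "loop_free_at G v" "pairing G v P"
  shows "inj_on (new_edge G v) P"
proof (rule inj_onI)
  fix p q assume pq: "p \<in> P" "q \<in> P" "new_edge G v p = new_edge G v q"
  obtain e f a b where p: "p = {e, f}" "e \<in> incident G v" "new_edge G v p = {a, b}" "a \<in> e"
    using new_edge_pair[OF assms pq(1)] by metis
  have "a \<in> new_edge G v q" using p(3) unfolding pq(3) by simp
  then obtain e' where e': "e' \<in> q" "a \<in> e'" by (auto simp: new_edge_def)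
  have "e' \<in> edges G" "e \<in> edges G"
    using e' p pq assms(3) by (auto simp: pairing_def incident_def)
  then have "e' = e"
    using multigraph_unique_edge[OF assms(1)] e'(2) p(4) by blast
  then have "e \<in> p \<inter> q" using e' p by auto
  then show "p = q"
    using assms(3) pq(1,2) unfolding pairing_def disjoint_def by blast
qed

lemma new_edge_disjoint:
  assumes "multigraph G" "pairing G v P" "p \<in> P" "e \<in> edges G" "e \<notin> p"
  shows "e \<inter> new_edge G v p = {}"
proof -
  have "p \<subseteq> edges G" using assms(2,3) by (auto simp: pairing_def incident_def)
  then show ?thesis
    using multigraph_unique_edge[OF assms(1,4)] assms(5) unfolding new_edge_def by blast
qed

lemma finite_pairing:
  assumes "multigraph G" "pairing G v P"
  shows "finite P" "\<And>p. p \<in> P \<Longrightarrow> finite p"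
proof -
  have "\<Union>P \<subseteq> edges G" using assms by (auto simp: pairing_def incident_def)
  then have "finite (\<Union>P)" by (rule finite_subset) (rule multigraph_finite[OF assms(1)])
  then show "finite P" by (rule finite_UnionD)
  show "finite p" if "p \<in> P" for p
    using that assms(2) by (simp add: pairing_def card_ge_0_finite)
qed

lemma multigraph_split_off:
  assumes "multigraph G" "loop_free_at G v" "pairing G v P"
  shows "multigraph (split_off G v P)"
proof -
  let ?E = "edges G - \<Union>P" and ?N = "new_edge G v ` P"
  have finP: "finite P"
    by (rule finite_pairing[OF assms(1,3)])
  have N: "card e = 2 \<and> e \<subseteq> \<Union>(edges G) \<and> vert G ` e \<subseteq> verts G" if "e \<in> ?N" for e
  proof -
    from that obtain p where p: "p \<in> P" "e = new_edge G v p" by blast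
    from new_edge_pair[OF assms p(1)] obtain e' f a b where
      "e' \<in> incident G v" "f \<in> incident G v" "e = {a, b}" "a \<noteq> b" "a \<in> e'" "b \<in> f"
      "vert G a \<in> verts G" "vert G b \<in> verts G" using p(2) by metis
    then show ?thesis by (auto simp: incident_def)
  qed
  have dis: "e \<inter> f = {}" if "e \<in> ?E" "f \<in> ?N" for e f
    using that new_edge_disjoint[OF assms(1,3)] by blast
  have disN: "new_edge G v p \<inter> new_edge G v q = {}" if "p \<in> P" "q \<in> P" "p \<noteq> q" for p q
  proof -
    have "p \<inter> q = {}" using that assms(3) unfolding pairing_def disjoint_def by blast
    moreover have "p \<subseteq> edges G" using that assms(3) by (auto simp: pairing_def incident_def)
    ultimately have "e \<inter> new_edge G v q = {}" if "e \<in> p" for e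
      using new_edge_disjoint[OF assms(1,3) \<open>q \<in> P\<close>, of e] that by blast
    then show ?thesis by (auto simp: new_edge_def)
  qed
  have "disjoint (?E \<union> ?N)"
  proof (rule disjointI)
    fix a b assume ab: "a \<in> ?E \<union> ?N" "b \<in> ?E \<union> ?N" "a \<noteq> b"
    then consider "a \<in> ?E" "b \<in> ?E" | "a \<in> ?E" "b \<in> ?N" | "a \<in> ?N" "b \<in> ?E" | "a \<in> ?N" "b \<in> ?N"
      by blast
    then show "a \<inter> b = {}"
    proof cases
      case 1 then show ?thesis using multigraph_unique_edge[OF assms(1)] ab(3) by blast
    next
      case 2 then show ?thesis by (rule dis)
    next
      case 3 then show ?thesis using dis by blast
    next
      case 4 then show ?thesis using disN ab(3) by blast
    qed
  qed
  moreover have "vert G ` \<Union>(?E \<union> ?N) \<subseteq> verts G"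
  proof -
    have "vert G ` e \<subseteq> verts G" if "e \<in> edges G" for e
      using that assms(1) by (auto simp: multigraph_def)
    then show ?thesis using N by (auto simp: image_subset_iff)
  qed
  moreover have "card e = 2" if "e \<in> ?E \<union> ?N" for e
    using that N assms(1) by (auto simp: multigraph_def)
  moreover have "finite (?E \<union> ?N)"
    using finP assms(1) by (simp add: multigraph_finite)
  ultimately show ?thesis
    using assms(1) by (simp add: multigraph_def split_off_def)
qed

text \<open>As \<open>v\<close> is outside \<open>S\<close>, an edge at \<open>v\<close> crosses
  \<open>S\<close> iff its far end lies in \<open>S\<close>. Merging two edges preserves the number
  of crossings unless both far ends are in \<open>S\<close>, when two crossings disappear. The
  additive form avoids subtraction of naturals.\<close>

lemma cutsize_split_off:
  assumes "multigraph G" "loop_free_at G v" "pairing G v P" "v \<notin> S"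
  shows "cutsize (split_off G v P) S + 2 * card {p \<in> P. \<forall>e\<in>p. vert G ` e \<inter> S \<noteq> {}} = cutsize G S"
proof -
  let ?E = "edges G - \<Union>P" and ?N = "new_edge G v ` P"
  let ?c = "\<lambda>e. of_bool (crossing G S e) :: nat"
  note fin = finite_pairing[OF assms(1,3)]
  have sub: "\<Union>P \<subseteq> edges G" using assms(3) by (auto simp: pairing_def incident_def)
  have pair: "sum ?c p = ?c (new_edge G v p) + 2 * of_bool (\<forall>e\<in>p. vert G ` e \<inter> S \<noteq> {})"
    if "p \<in> P" for p
  proof (rule new_edge_pair[OF assms(1-3) that])
    fix e f a b
    assume *: "p = {e, f}" "e \<noteq> f" "new_edge G v p = {a, b}"
    "vert G ` e = {v, vert G a}" "vert G ` f = {v, vert G b}" "vert G a \<noteq> v" "vert G b \<noteq> v"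
    then show ?thesis using assms(4) by (auto simp: crossing_def)
  qed
  have EN: "?E \<inter> ?N = {}"
  proof -
    have "e \<noteq> new_edge G v p" if "e \<in> ?E" "p \<in> P" for e p
    proof -
      have "e \<inter> new_edge G v p = {}" using new_edge_disjoint[OF assms(1,3)] that by blast
      moreover have "new_edge G v p \<noteq> {}"
        using new_edge_pair[OF assms(1-3) that(2)] by (metis insert_not_empty)
      ultimately show ?thesis by auto
    qed
    then show ?thesis by blast
  qed
  have mg: "finite (edges (split_off G v P))"
    using multigraph_split_off[OF assms(1-3)] by (rule multigraph_finite)
  have "cutsize (split_off G v P) S = (\<Sum>e\<in>?E \<union> ?N. ?c e)"
    by (subst cutsize_sum[OF mg]) (auto simp: split_off_def crossing_def)
  also have "\<dots> = sum ?c ?E + sum ?c ?N"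
    using fin EN assms(1) by (intro sum.union_disjoint) (auto simp: multigraph_finite)
  also have "sum ?c ?N = (\<Sum>p\<in>P. ?c (new_edge G v p))"
    using inj_on_new_edge[OF assms(1-3)] by (simp add: sum.reindex)
  finally have 1: "cutsize (split_off G v P) S = sum ?c ?E + (\<Sum>p\<in>P. ?c (new_edge G v p))" .
  have "cutsize G S = sum ?c ?E + sum ?c (\<Union>P)"
    using multigraph_finite(1)[OF assms(1)] by (simp only: cutsize_sum sum.subset_diff[OF sub])
  also have "sum ?c (\<Union>P) = (\<Sum>p\<in>P. sum ?c p)"
  proof -
    have "\<forall>p\<in>P. \<forall>q\<in>P. p \<noteq> q \<longrightarrow> p \<inter> q = {}"
      using assms(3) unfolding pairing_def disjoint_def by blast
    then show ?thesis using fin by (simp add: sum.Union_disjoint del: sum_of_bool_eq)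
  qed
  also have "\<dots> = (\<Sum>p\<in>P. ?c (new_edge G v p) + 2 * of_bool (\<forall>e\<in>p. vert G ` e \<inter> S \<noteq> {}))"
    by (rule sum.cong[OF refl]) (rule pair)
  also have "\<dots> = (\<Sum>p\<in>P. ?c (new_edge G v p)) + 2 * card {p \<in> P. \<forall>e\<in>p. vert G ` e \<inter> S \<noteq> {}}"
    using fin by (simp add: sum.distrib Int_def flip: sum_distrib_left)
  finally show ?thesis using 1 by simp
qed

section \<open>Resolving a vertex and good transitions\<close>

definition conn :: "nat \<Rightarrow> ('v, 'h) graph \<Rightarrow> bool" where
  "conn m G \<longleftrightarrow> (\<forall>S. S \<noteq> {} \<longrightarrow> S \<subset> verts G \<longrightarrow> m \<le> cutsize G S)"

definition good :: "nat \<Rightarrow> ('v, 'h) graph \<Rightarrow> 'v \<Rightarrow> 'h set set set set" where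
  "good m G v = {\<tau> \<in> transitions G v. conn m (resolve G v \<tau>)}"

lemma transitions_pairing:
  assumes "\<tau> \<in> transitions G v"
  shows "pairing G v \<tau>" "\<Union>\<tau> = incident G v"
  using assms by (auto simp: transitions_def pairing_def partition_on_def)

lemma resolve_eq_split_off:
  assumes "\<tau> \<in> transitions G v"
  shows "resolve G v \<tau> = split_off G v \<tau>\<lparr>verts := verts G - {v}\<rparr>"
  using transitions_pairing[OF assms] by (simp add: resolve_def split_off_def new_edge_def)

lemma cutsize_resolve:
  assumes "multigraph G" "loop_free_at G v" "\<tau> \<in> transitions G v" "v \<notin> S"
  shows "cutsize (resolve G v \<tau>) S + 2 * card {p \<in> \<tau>. \<forall>e\<in>p. vert G ` e \<inter> S \<noteq> {}} = cutsize G S"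
  using cutsize_split_off[OF assms(1,2) transitions_pairing(1)[OF assms(3)] assms(4)]
  by (simp add: resolve_eq_split_off[OF assms(3)] cutsize_def crossing_def)

lemma verts_resolve [simp]: "verts (resolve G v \<tau>) = verts G - {v}"
  by (simp add: resolve_def)

lemma new_edge_not_incident: "v \<notin> vert G ` new_edge G v p"
  by (auto simp: new_edge_def)

lemma multigraph_resolve:
  assumes "multigraph G" "loop_free_at G v" "\<tau> \<in> transitions G v"
  shows "multigraph (resolve G v \<tau>)"
proof -
  have "multigraph (split_off G v \<tau>)"
    using multigraph_split_off[OF assms(1,2) transitions_pairing(1)[OF assms(3)]] .
  moreover have "v \<notin> vert G ` e" if "e \<in> edges (split_off G v \<tau>)" for e
  proof -
    have "e \<in> edges G - incident G v \<or> e \<in> new_edge G v ` \<tau>"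
      using that transitions_pairing(2)[OF assms(3)] by (auto simp: split_off_def)
    then show ?thesis by (auto simp: incident_def new_edge_def)
  qed
  ultimately show ?thesis
    unfolding resolve_eq_split_off[OF assms(3)] by (fastforce simp: multigraph_def split_off_def)
qed

lemma finite_incident: "multigraph G \<Longrightarrow> finite (incident G v)"
  by (simp add: multigraph_finite incident_def)

lemma finite_transitions:
  assumes "multigraph G"
  shows "finite (transitions G v)"
proof (rule finite_subset)
  show "transitions G v \<subseteq> Pow (Pow (incident G v))"
    using transitions_pairing(2) by fastforce
qed (simp add: finite_incident assms)

lemma finite_good: "multigraph G \<Longrightarrow> finite (good m G v)"
  by (simp add: good_def finite_transitions)

lemma incident_split_off:
  assumes "\<Union>P \<subseteq> incident G v"
  shows "incident (split_off G v P) v = incident G v - \<Union>P"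
  using assms new_edge_not_incident[of v G] by (auto simp: incident_def split_off_def)

section \<open>Splitting off a single pair, admissible partners and their number\<close>

definition split_pair :: "('v, 'h) graph \<Rightarrow> 'v \<Rightarrow> 'h set \<Rightarrow> 'h set \<Rightarrow> ('v, 'h) graph" where
  "split_pair G v e f = split_off G v {{e, f}}"

lemma pairing_singleton:
  assumes "e \<in> incident G v" "f \<in> incident G v" "e \<noteq> f"
  shows "pairing G v {{e, f}}"
  using assms by (auto simp: pairing_def)

lemma incident_split_pair:
  assumes "e \<in> incident G v" "f \<in> incident G v"
  shows "incident (split_pair G v e f) v = incident G v - {e, f}"
  using incident_split_off[of "{{e, f}}" G v] assms by (simp add: split_pair_def)

lemma cutsize_split_pair:
  assumes "multigraph G" "loop_free_at G v" "e \<in> incident G v" "f \<in> incident G v" "e \<noteq> f" "v \<notin> S"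
  shows "cutsize (split_pair G v e f) S
    + (if vert G ` e \<inter> S \<noteq> {} \<and> vert G ` f \<inter> S \<noteq> {} then 2 else 0) = cutsize G S"
proof -
  have "{p \<in> {{e, f}}. \<forall>e\<in>p. vert G ` e \<inter> S \<noteq> {}} =
    (if vert G ` e \<inter> S \<noteq> {} \<and> vert G ` f \<inter> S \<noteq> {} then {{e, f}} else {})"
    by auto
  then show ?thesis
    using cutsize_split_off[OF assms(1,2) pairing_singleton[OF assms(3-5)] assms(6)]
    by (simp add: split_pair_def split: if_splits)
qed

text \<open>The new edge avoids \<open>v\<close>, so splitting off one pair first and resolving the
  others afterwards gives the same graph. The third fact lets the partner of \<open>e\<close> be
  read off from a transition.\<close>

lemma split_pair_transition:
  assumes "e \<in> incident G v" "f \<in> incident G v" "e \<noteq> f" "\<tau> \<in> transitions (split_pair G v e f) v"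
  shows "insert {e, f} \<tau> \<in> transitions G v"
    and "resolve G v (insert {e, f} \<tau>) = resolve (split_pair G v e f) v \<tau>"
    and "\<forall>p\<in>\<tau>. e \<notin> p"
proof -
  have part: "partition_on (incident G v - {e, f}) \<tau>" and c: "\<forall>p\<in>\<tau>. card p = 2"
    using assms(4) incident_split_pair[OF assms(1,2)] by (auto simp: transitions_def)
  then show "\<forall>p\<in>\<tau>. e \<notin> p" by (auto simp: partition_on_def)
  have un: "\<Union>\<tau> = incident G v - {e, f}"
    using part by (simp add: partition_on_def)
  have "partition_on (incident G v) (insert {e, f} \<tau>)"
    unfolding partition_on_def
  proof (intro conjI)
    show "\<Union> (insert {e, f} \<tau>) = incident G v" using un assms(1,2) by auto
    have "disjoint \<tau>" using part by (simp add: partition_on_def)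
    moreover have "{e, f} \<inter> \<Union>\<tau> = {}" using un by auto
    ultimately show "disjoint (insert {e, f} \<tau>)" by (auto simp: disjoint_def)
    show "{} \<notin> insert {e, f} \<tau>" using part by (simp add: partition_on_def)
  qed
  then show "insert {e, f} \<tau> \<in> transitions G v"
    using c assms(3) by (simp add: transitions_def)
  let ?n = "new_edge G v {e, f}"
  have inc: "incident (split_off G v {{e, f}}) v = incident G v - {e, f}"
    using incident_split_pair[OF assms(1,2)] by (simp add: split_pair_def)
  have n: "?n \<notin> incident G v" using new_edge_not_incident[of v G] by (auto simp: incident_def)
  show "resolve G v (insert {e, f} \<tau>) = resolve (split_pair G v e f) v \<tau>"
    unfolding split_pair_def resolve_def inc
    using assms(1,2) n by (auto simp: split_off_def new_edge_def)
qed

text \<open>The invariant while pairs are split off one by one. The lower bound leaves out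
  \<open>verts G - {v}\<close>, because its cut consists of the 2j edges remaining at
  \<open>v\<close>, and j decreases.\<close>

definition splittable :: "nat \<Rightarrow> ('v, 'h) graph \<Rightarrow> 'v \<Rightarrow> nat \<Rightarrow> bool" where
  "splittable m G v j \<longleftrightarrow> multigraph G \<and> v \<in> verts G \<and> loop_free_at G v \<and>
     card (incident G v) = 2 * j \<and> (\<forall>S. S \<subseteq> verts G - {v} \<longrightarrow> even (cutsize G S)) \<and>
     (\<forall>S. S \<noteq> {} \<longrightarrow> S \<subset> verts G - {v} \<longrightarrow> m \<le> cutsize G S)"

definition admissible :: "nat \<Rightarrow> ('v, 'h) graph \<Rightarrow> 'v \<Rightarrow> 'h set \<Rightarrow> 'h set set" where
  "admissible m G v e = {f \<in> incident G v - {e}.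
     \<forall>S. S \<noteq> {} \<longrightarrow> S \<subset> verts G - {v} \<longrightarrow> m \<le> cutsize (split_pair G v e f) S}"

lemma splittable_cutsize_ge:
  "splittable m G v j \<Longrightarrow> S \<noteq> {} \<Longrightarrow> S \<subset> verts G - {v} \<Longrightarrow> m \<le> cutsize G S"
  by (simp add: splittable_def)

lemma splittable_split_pair:
  assumes "splittable m G v (Suc j)" "e \<in> incident G v" "f \<in> admissible m G v e"
  shows "splittable m (split_pair G v e f) v j"
proof -
  have G: "multigraph G" "v \<in> verts G" "loop_free_at G v" "card (incident G v) = 2 * Suc j"
    using assms(1) by (auto simp: splittable_def)
  have f: "f \<in> incident G v" "e \<noteq> f" using assms(3) by (auto simp: admissible_def)
  have V: "verts (split_pair G v e f) = verts G" by (simp add: split_pair_def split_off_def)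
  have "multigraph (split_pair G v e f)"
    unfolding split_pair_def using multigraph_split_off[OF G(1,3) pairing_singleton[OF assms(2) f]] .
  moreover have "loop_free_at (split_pair G v e f) v"
    using G(3) new_edge_not_incident[of v G "{e, f}"]
    by (auto simp: loop_free_at_def split_pair_def split_off_def)
  moreover have "card (incident (split_pair G v e f) v) = 2 * j"
    using G(4) f assms(2) by (simp add: incident_split_pair card_Diff_subset)
  moreover have "even (cutsize (split_pair G v e f) S)" if S: "S \<subseteq> verts G - {v}" for S
  proof -
    have "v \<notin> S" using S by auto
    note * = cutsize_split_pair[OF G(1,3) assms(2) f this]
    have "even (cutsize G S)" using assms(1) S by (simp add: splittable_def)
    then show ?thesis unfolding *[symmetric] by (simp split: if_splits)
  qed
  ultimately show ?thesis
    using G(2) assms(3) unfolding splittable_def V admissible_def by blast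
qed

text \<open>Choosing a partner \<open>f\<close> of the fixed edge \<open>e\<close> and then a good
  transition of the remainder never yields the same transition twice, since the pair containing
  \<open>e\<close> reveals \<open>f\<close>.\<close>

lemma card_good_ge_admissible:
  assumes "splittable m G v j" "e \<in> incident G v"
    and "\<And>f. f \<in> admissible m G v e \<Longrightarrow> N \<le> card (good m (split_pair G v e f) v)"
  shows "card (admissible m G v e) * N \<le> card (good m G v)"
proof -
  let ?A = "admissible m G v e"
  let ?S = "SIGMA f:?A. good m (split_pair G v e f) v"
  let ?F = "\<lambda>(f, \<tau>). insert {e, f} \<tau>"
  have G: "multigraph G" using assms(1) by (simp add: splittable_def)
  have A: "f \<in> incident G v" "e \<noteq> f" if "f \<in> ?A" for f
    using that by (auto simp: admissible_def)
  have finA: "finite ?A"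
    using finite_incident[OF G] by (simp add: admissible_def)
  have trans: "\<tau> \<in> transitions (split_pair G v e f) v" if "\<tau> \<in> good m (split_pair G v e f) v" for f \<tau>
    using that by (simp add: good_def)
  have "inj_on ?F ?S"
  proof (rule inj_onI, clarify)
    fix f \<tau> g \<sigma> assume f: "f \<in> ?A" "\<tau> \<in> good m (split_pair G v e f) v"
      and g: "g \<in> ?A" "\<sigma> \<in> good m (split_pair G v e g) v" and eq: "insert {e, f} \<tau> = insert {e, g} \<sigma>"
    have 1: "\<forall>p\<in>\<tau>. e \<notin> p" using split_pair_transition(3)[OF assms(2) A[OF f(1)] trans[OF f(2)]] .
    have 2: "\<forall>p\<in>\<sigma>. e \<notin> p" using split_pair_transition(3)[OF assms(2) A[OF g(1)] trans[OF g(2)]] .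
    have "{e, f} = {e, g}" using 1 2 eq by (metis insertI1 insert_iff)
    then have "f = g" using A f(1) g(1) by (metis doubleton_eq_iff)
    moreover have "\<tau> = \<sigma>"
      using eq 1 2 \<open>{e, f} = {e, g}\<close> by (metis insertI1 insert_ident)
    ultimately show "f = g \<and> \<tau> = \<sigma>" by simp
  qed
  moreover have "?F ` ?S \<subseteq> good m G v"
  proof (clarify)
    fix f \<tau> assume f: "f \<in> ?A" "\<tau> \<in> good m (split_pair G v e f) v"
    note * = split_pair_transition[OF assms(2) A[OF f(1)] trans[OF f(2)]]
    have "conn m (resolve (split_pair G v e f) v \<tau>)" using f(2) by (simp add: good_def)
    then show "insert {e, f} \<tau> \<in> good m G v" using *(1,2) by (simp add: good_def)
  qed
  ultimately have "card ?S \<le> card (good m G v)"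
    by (rule card_inj_on_le) (rule finite_good[OF G])
  moreover have "card ?S = (\<Sum>f\<in>?A. card (good m (split_pair G v e f) v))"
  proof (rule card_SigmaI[OF finA], clarify)
    fix f assume "f \<in> ?A"
    then have "multigraph (split_pair G v e f)"
      unfolding split_pair_def using assms(1,2) A
      by (intro multigraph_split_off pairing_singleton) (auto simp: splittable_def)
    then show "finite (good m (split_pair G v e f) v)" by (rule finite_good)
  qed
  moreover have "(\<Sum>f\<in>?A. N) \<le> (\<Sum>f\<in>?A. card (good m (split_pair G v e f) v))"
    by (intro sum_mono assms(3))
  ultimately show ?thesis by simp
qed

text \<open>Splitting off a pair lowers a cut by 0 or 2. If a cut of at least \<open>m\<close> falls
  below \<open>m\<close>, both edges reach into \<open>S\<close>, and parity rules out that it was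
  \<open>m + 1\<close>.\<close>

lemma inadmissible_tight:
  assumes "splittable m G v j" "even m" "e \<in> incident G v" "f \<in> incident G v - {e}"
    "f \<notin> admissible m G v e"
  obtains S where "S \<subset> verts G - {v}" "vert G ` e \<inter> S \<noteq> {}" "vert G ` f \<inter> S \<noteq> {}" "cutsize G S = m"
proof -
  have G: "multigraph G" "loop_free_at G v"
    using assms(1) by (auto simp: splittable_def)
  have f: "f \<in> incident G v" "e \<noteq> f" using assms(4) by auto
  obtain S where S: "S \<noteq> {}" "S \<subset> verts G - {v}" "cutsize (split_pair G v e f) S < m"
  proof -
    have "\<not> (\<forall>S. S \<noteq> {} \<longrightarrow> S \<subset> verts G - {v} \<longrightarrow> m \<le> cutsize (split_pair G v e f) S)"
      using assms(4,5) by (simp add: admissible_def)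
    then show thesis using that by (metis not_le)
  qed
  have ev: "even (cutsize G S)" and le: "m \<le> cutsize G S"
    using assms(1) S by (auto simp: splittable_def)
  have "v \<notin> S" using S by auto
  note * = cutsize_split_pair[OF G assms(3) f this]
  have both: "vert G ` e \<inter> S \<noteq> {} \<and> vert G ` f \<inter> S \<noteq> {}"
    using * le S(3) by (auto split: if_splits)
  then have "cutsize (split_pair G v e f) S + 2 = cutsize G S"
    using * by (simp only: if_True simp_thms)
  then have "cutsize G S \<le> Suc m" using S(3) by simp
  then have "cutsize G S = m"
    using ev le assms(2) by (metis even_Suc le_SucE le_antisym)
  then show thesis using that S(2) both by blast
qed

text \<open>
  The sets witnessing that partners of \<open>e\<close> are inadmissible are closed under union; the largest
  one is then met by at most half of the edges at \<open>v\<close>.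
\<close>

lemma tight_Un:
  assumes "splittable m G v j" "e \<in> incident G v" "s \<in> vert G ` e"
    and A: "A \<subset> verts G - {v}" "s \<in> A" "cutsize G A = m"
    and B: "B \<subset> verts G - {v}" "s \<in> B" "cutsize G B = m"
  shows "A \<union> B \<subset> verts G - {v} \<and> cutsize G (A \<union> B) = m"
proof -
  have G: "multigraph G" using assms(1) by (simp add: splittable_def)
  have ge: "m \<le> cutsize G S" if "S \<noteq> {}" "S \<subset> verts G - {v}" for S
    using splittable_cutsize_ge[OF assms(1) that] .
  have e: "e \<in> edges G" "v \<in> vert G ` e" using assms(2) by (auto simp: incident_def)
  \<comment> \<open>Otherwise \<open>e\<close> runs from \<open>s\<close> in the intersection to
    \<open>v\<close> outside the union, and the strict inequality pushes the cut of one difference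
    below \<open>m\<close>.\<close>
  have "A \<union> B \<noteq> verts G - {v}"
  proof
    assume AB: "A \<union> B = verts G - {v}"
    have "A - B \<noteq> {}" "B - A \<noteq> {}" using A(1) B(1) AB by auto
    moreover have "A - B \<subset> verts G - {v}" "B - A \<subset> verts G - {v}"
      using A(1) B(1) by blast+
    ultimately have "m \<le> cutsize G (A - B)" "m \<le> cutsize G (B - A)"
      using ge[of "A - B"] ge[of "B - A"] by simp_all
    moreover have "cutsize G (A - B) + cutsize G (B - A) + 2 \<le> cutsize G A + cutsize G B"
      using A B AB assms(3) e by (intro cutsize_posimod_strict[OF G e(1)]) auto
    ultimately show False using A B by simp
  qed
  then have sub: "A \<union> B \<subset> verts G - {v}" using A(1) B(1) by auto
  moreover have "m \<le> cutsize G (A \<union> B)" using sub A(2) by (intro ge) auto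
  moreover have "m \<le> cutsize G (A \<inter> B)" using A B by (intro ge) auto
  moreover have "cutsize G (A \<inter> B) + cutsize G (A \<union> B) \<le> cutsize G A + cutsize G B"
    by (rule cutsize_submod[OF G])
  ultimately show ?thesis using A B by simp
qed

lemma cutsize_singleton:
  assumes "multigraph G" "loop_free_at G v"
  shows "cutsize G {v} = card (incident G v)"
proof -
  have "crossing G {v} e \<longleftrightarrow> v \<in> vert G ` e" if "e \<in> edges G" for e
    using assms(1) that
    by (rule multigraph_edge) (use assms(2) that in \<open>auto simp: crossing_def loop_free_at_def\<close>)
  then show ?thesis
    unfolding cutsize_def incident_def by (metis (mono_tags, lifting) Collect_cong)
qed

text \<open>With r edges from \<open>v\<close> to \<open>X\<close>, the cut of
  \<open>X \<union> {v}\<close> is \<open>m\<close> + 2j - 2r. It is also the cut of the remaining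
  vertices and hence at least \<open>m\<close>, so r is at most j.\<close>

lemma card_edges_to_tight:
  assumes "splittable m G v j" "X \<noteq> {}" "X \<subset> verts G - {v}" "cutsize G X = m"
  shows "card {f \<in> incident G v. vert G ` f \<inter> X \<noteq> {}} \<le> j"
proof -
  have G: "multigraph G" "v \<in> verts G" "loop_free_at G v" "card (incident G v) = 2 * j"
    using assms(1) by (auto simp: splittable_def)
  let ?r = "card {f \<in> edges G. vert G ` f \<inter> X \<noteq> {} \<and> vert G ` f \<inter> {v} \<noteq> {}}"
  have "X \<inter> {v} = {}" using assms(3) by auto
  from cutsize_Un_disjoint[OF G(1) this]
  have "m + 2 * j = cutsize G (X \<union> {v}) + 2 * ?r"
    using assms(4) G(4) cutsize_singleton[OF G(1,3)] by simp
  moreover have "cutsize G (X \<union> {v}) = cutsize G (verts G - (X \<union> {v}))"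
    using G(2) assms(3) by (intro cutsize_Diff[OF G(1), symmetric]) auto
  moreover have "m \<le> cutsize G (verts G - (X \<union> {v}))"
  proof -
    have "verts G - (X \<union> {v}) \<noteq> {}" "verts G - (X \<union> {v}) \<subset> verts G - {v}"
      using assms(2,3) by auto
    then show ?thesis by (rule splittable_cutsize_ge[OF assms(1)])
  qed
  moreover have "{f \<in> incident G v. vert G ` f \<inter> X \<noteq> {}} =
      {f \<in> edges G. vert G ` f \<inter> X \<noteq> {} \<and> vert G ` f \<inter> {v} \<noteq> {}}"
    by (auto simp: incident_def)
  ultimately show ?thesis by simp
qed

lemma card_admissible:
  assumes "splittable m G v j" "e \<in> incident G v"
    and "incident G v - {e} - admissible m G v e \<subseteq> R - {e}" "e \<in> R" "R \<subseteq> incident G v"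
  shows "2 * j \<le> card (admissible m G v e) + card R"
proof -
  have fin: "finite (incident G v)"
    using assms(1) by (simp add: splittable_def finite_incident)
  then have finR: "finite R" "finite (admissible m G v e)"
    using assms(5) by (auto simp: admissible_def intro: finite_subset)
  have "incident G v \<subseteq> admissible m G v e \<union> R" using assms(3,4) by auto
  then have "card (incident G v) \<le> card (admissible m G v e \<union> R)"
    using finR by (intro card_mono) auto
  also have "\<dots> \<le> card (admissible m G v e) + card R" by (rule card_Un_le)
  finally show ?thesis using assms(1) by (simp add: splittable_def)
qed

lemma card_admissible_ge:
  assumes "splittable m G v (Suc j)" "even m" "e \<in> incident G v"
  shows "Suc j \<le> card (admissible m G v e)"
proof -
  have G: "multigraph G" "loop_free_at G v" "finite (verts G)"
    using assms(1) by (auto simp: splittable_def multigraph_finite)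
  obtain h h' where h: "e = {h, h'}" "h \<noteq> h'" "vert G h = v" "vert G h' \<noteq> v"
    using incident_edge[OF G(1,2) assms(3)] by metis
  \<comment> \<open>A tight set avoids \<open>v\<close>, so it can meet \<open>e\<close> only in the
    far end \<open>s\<close>; all obstructing sets therefore share \<open>s\<close>, as
    \<open>tight_Un\<close> requires.\<close>
  define s where "s = vert G h'"
  have s: "s \<in> vert G ` e" by (simp add: h(1) s_def)
  define T where "T = {S. S \<subset> verts G - {v} \<and> s \<in> S \<and> cutsize G S = m}"
  have T: "\<exists>S\<in>T. vert G ` f \<inter> S \<noteq> {}" if "f \<in> incident G v - {e} - admissible m G v e" for f
  proof -
    obtain S where "S \<subset> verts G - {v}" "vert G ` e \<inter> S \<noteq> {}" "vert G ` f \<inter> S \<noteq> {}" "cutsize G S = m"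
      using inadmissible_tight[OF assms, of f] \<open>f \<in> _\<close> by blast
    moreover from this have "s \<in> S" by (auto simp: h s_def)
    ultimately show ?thesis by (auto simp: T_def)
  qed
  show ?thesis
  proof (cases "T = {}")
    case True
    then have "incident G v - {e} - admissible m G v e \<subseteq> {e} - {e}" using T by auto
    from card_admissible[OF assms(1,3) this] show ?thesis using assms(3) by simp
  next
    case False
    have "finite T"
      by (rule finite_subset[of _ "Pow (verts G)"]) (auto simp: T_def G)
    then obtain X where X: "X \<in> T" "\<And>S. S \<in> T \<Longrightarrow> X \<subseteq> S \<Longrightarrow> S = X"
      using finite_has_maximal[OF _ False] by metis
    have le: "S \<subseteq> X" if "S \<in> T" for S
    proof -
      have "X \<union> S \<in> T"
        using tight_Un[OF assms(1,3) s, of X S] X(1) that by (auto simp: T_def)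
      then show ?thesis using X(2)[of "X \<union> S"] by auto
    qed
    let ?R = "{f \<in> incident G v. vert G ` f \<inter> X \<noteq> {}}"
    have "card ?R \<le> Suc j"
      using X(1) by (intro card_edges_to_tight[OF assms(1)]) (auto simp: T_def)
    moreover have "2 * Suc j \<le> card (admissible m G v e) + card ?R"
    proof (rule card_admissible[OF assms(1,3)])
      show "incident G v - {e} - admissible m G v e \<subseteq> ?R - {e}"
        using T le by fastforce
      \<comment> \<open>\<open>e\<close> itself is one of the at most \<open>Suc j\<close> edges
        into \<open>X\<close>, so excluding it as its own partner costs nothing extra.\<close>
      show "e \<in> ?R" using X(1) s assms(3) by (auto simp: T_def)
    qed auto
    ultimately show ?thesis by simp
  qed
qed

lemma splittable_0_good:
  assumes "splittable m G v 0"
  shows "{} \<in> good m G v"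
proof -
  have G: "multigraph G" "incident G v = {}"
    using assms finite_incident[of G v] by (auto simp: splittable_def)
  have "{} \<in> transitions G v"
    by (simp add: transitions_def G partition_on_def)
  moreover have "cutsize (resolve G v {}) S = cutsize G S" for S
    by (simp add: resolve_def G cutsize_def crossing_def)
  ultimately show ?thesis
    using splittable_cutsize_ge[OF assms] by (simp add: good_def conn_def)
qed

lemma card_good_ge:
  assumes "splittable m G v j" "even m"
  shows "fact j \<le> card (good m G v)"
  using assms(1)
proof (induction j arbitrary: G)
  case 0
  then have "{} \<in> good m G v" "finite (good m G v)"
    using splittable_0_good[of m G v] finite_good[of G m v] by (simp_all add: splittable_def)
  then have "0 < card (good m G v)" by (auto simp: card_gt_0_iff)
  then show ?case by simp
next
  case (Suc j)
  have "card (incident G v) = 2 * Suc j" using Suc.prems by (simp add: splittable_def)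
  then obtain e where e: "e \<in> incident G v"
    by (metis Suc_neq_Zero card.empty ex_in_conv mult_eq_0_iff zero_neq_numeral)
  have "card (admissible m G v e) * fact j \<le> card (good m G v)"
    using Suc.IH splittable_split_pair[OF Suc.prems e]
    by (intro card_good_ge_admissible[OF Suc.prems e]) auto
  moreover have "Suc j * fact j \<le> card (admissible m G v e) * fact j"
    using card_admissible_ge[OF Suc.prems assms(2) e] by (rule mult_le_mono1)
  ultimately show ?case by simp
qed

section \<open>Well-connected regular graphs\<close>

definition well_connected :: "nat \<Rightarrow> ('v, 'h) graph \<Rightarrow> bool" where
  "well_connected k G \<longleftrightarrow>
     multigraph G \<and> 2 \<le> card (verts G) \<and> regular (2 * k) G \<and> conn (2 * k) G"

lemma edge_connected_iff_conn:
  assumes "multigraph G"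
  shows "edge_connected m G \<longleftrightarrow> conn m G"
proof
  assume L: "edge_connected m G"
  show "conn m G"
    unfolding conn_def
  proof (intro allI impI)
    fix S assume "S \<noteq> {}" "S \<subset> verts G"
    then have b: "bipartition G S (verts G - S)" by (auto simp: bipartition_def)
    then have "m \<le> card (edge_cut G S (verts G - S))" using L by (simp add: edge_connected_def)
    then show "m \<le> cutsize G S" using cutsize_eq_edge_cut[OF assms b] by simp
  qed
next
  assume R: "conn m G"
  show "edge_connected m G"
    unfolding edge_connected_def
  proof (intro allI impI)
    fix X Y assume b: "bipartition G X Y"
    then have "X \<noteq> {}" "X \<subset> verts G" by (auto simp: bipartition_def)
    then show "m \<le> card (edge_cut G X Y)"
      using R cutsize_eq_edge_cut[OF assms b] by (simp add: conn_def)
  qed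
qed

lemma loop_free_iff:
  assumes "multigraph G"
  shows "has_self_loop G \<longleftrightarrow> (\<exists>v\<in>verts G. \<not> loop_free_at G v)"
proof -
  have "v \<in> verts G" if "e \<in> edges G" "vert G ` e = {v}" for e v
    using assms that(1) by (rule multigraph_edge) (use that(2) in auto)
  then show ?thesis by (auto simp: has_self_loop_def loop_free_at_def)
qed

lemma degree_loop_free:
  assumes "multigraph G" "loop_free_at G v"
  shows "degree G v = cutsize G {v}"
proof -
  have "{e \<in> edges G. vert G ` e = {v}} = {}" using assms(2) by (auto simp: loop_free_at_def)
  then show ?thesis using degree_cutsize[OF assms(1), of v] by (simp only: card.empty)
qed

text \<open>With at least two vertices, \<open>{v}\<close> is a proper subset. Its cut of at least
  2k edges uses up the whole degree, leaving no half-edges for loops.\<close>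

lemma well_connected_vertex:
  assumes "well_connected k G" "v \<in> verts G"
  shows "loop_free_at G v" "cutsize G {v} = 2 * k"
proof -
  have G: "multigraph G" "degree G v = 2 * k" "2 \<le> card (verts G)" "conn (2 * k) G"
    using assms by (auto simp: well_connected_def regular_def)
  have "{v} \<subset> verts G" using G(3) assms(2) by (metis card_1_singleton_iff empty_subsetI insert_subset
      not_less_eq_eq numeral_2_eq_2 order_refl psubsetI One_nat_def)
  then have "2 * k \<le> cutsize G {v}" using G(4) by (simp add: conn_def)
  moreover note degree_cutsize[OF G(1), of v] G(2)
  ultimately have "card {e \<in> edges G. vert G ` e = {v}} = 0" "cutsize G {v} = 2 * k" by auto
  then show "loop_free_at G v" "cutsize G {v} = 2 * k"
    using multigraph_finite(1)[OF G(1)] by (auto simp: loop_free_at_def)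
qed

lemma well_connected_no_loop:
  assumes "well_connected k G"
  shows "\<not> has_self_loop G"
proof -
  have "multigraph G" using assms by (simp add: well_connected_def)
  then show ?thesis using well_connected_vertex(1)[OF assms] by (simp add: loop_free_iff)
qed

lemma well_connected_conn:
  "well_connected k G \<Longrightarrow> S \<noteq> {} \<Longrightarrow> S \<subset> verts G \<Longrightarrow> 2 * k \<le> cutsize G S"
  by (simp add: well_connected_def conn_def)

lemma well_connected_splittable:
  assumes "well_connected k G" "v \<in> verts G"
  shows "splittable (2 * k) G v k"
proof -
  have G: "multigraph G" "regular (2 * k) G" using assms by (auto simp: well_connected_def)
  note v = well_connected_vertex[OF assms]
  have "even (cutsize G S)" if "S \<subseteq> verts G - {v}" for S
  proof (rule even_cutsize[OF G(1)])
    show "finite S" using that multigraph_finite(2)[OF G(1)] by (auto intro: finite_subset)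
    show "even (degree G u)" if "u \<in> S" for u
      using that \<open>S \<subseteq> _\<close> G(2) by (auto simp: regular_def)
  qed
  moreover have "2 * k \<le> cutsize G S" if "S \<noteq> {}" "S \<subset> verts G - {v}" for S
    using that by (intro well_connected_conn[OF assms(1)]) auto
  ultimately show ?thesis
    using G(1) assms(2) v cutsize_singleton[OF G(1) v(1)] by (simp add: splittable_def)
qed

lemma fact_le_card_good:
  assumes "well_connected k G" "v \<in> verts G"
  shows "fact k \<le> card (good (2 * k) G v)"
  using card_good_ge[OF well_connected_splittable[OF assms]] by simp

text \<open>Resolving only regroups half-edges: those at \<open>v\<close> disappear, and the others
  keep their vertex.\<close>

lemma regular_resolve:
  assumes "multigraph G" "loop_free_at G v" "\<tau> \<in> transitions G v" "regular d G"
  shows "regular d (resolve G v \<tau>)"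
proof -
  have "degree (resolve G v \<tau>) u = degree G u" if "u \<noteq> v" for u
  proof -
    have un: "\<Union>\<tau> = incident G v" by (rule transitions_pairing[OF assms(3)])
    have "{h \<in> \<Union>(edges (resolve G v \<tau>)). vert G h = u} = {h \<in> \<Union>(edges G). vert G h = u}"
    proof (intro set_eqI iffI)
      fix h assume "h \<in> {h \<in> \<Union>(edges (resolve G v \<tau>)). vert G h = u}"
      then have "h \<in> \<Union>(edges G) \<or> h \<in> \<Union>(\<Union>\<tau>)" "vert G h = u" by (auto simp: resolve_def)
      then show "h \<in> {h \<in> \<Union>(edges G). vert G h = u}" unfolding un by (auto simp: incident_def)
    next
      fix h assume "h \<in> {h \<in> \<Union>(edges G). vert G h = u}"
      then obtain e where e: "e \<in> edges G" "h \<in> e" "vert G h = u" by auto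
      show "h \<in> {h \<in> \<Union>(edges (resolve G v \<tau>)). vert G h = u}"
      proof (cases "e \<in> incident G v")
        case False then show ?thesis using e by (auto simp: resolve_def)
      next
        case True
        then obtain p where "p \<in> \<tau>" "e \<in> p" unfolding un[symmetric] by auto
        then have "h \<in> {h \<in> \<Union>p. vert G h \<noteq> v}" using e that by auto
        then show ?thesis using e(3) \<open>p \<in> \<tau>\<close> by (auto simp: resolve_def)
      qed
    qed
    then show ?thesis by (simp add: degree_def resolve_def)
  qed
  then show ?thesis using assms(4) by (simp add: regular_def)
qed

lemma well_connected_resolve:
  assumes "well_connected k G" "v \<in> verts G" "3 \<le> card (verts G)" "\<tau> \<in> good (2 * k) G v"
  shows "well_connected k (resolve G v \<tau>)"
proof -
  have G: "multigraph G" "regular (2 * k) G" using assms by (auto simp: well_connected_def)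
  have t: "\<tau> \<in> transitions G v" "conn (2 * k) (resolve G v \<tau>)" using assms(4) by (auto simp: good_def)
  note v = well_connected_vertex(1)[OF assms(1,2)]
  have "2 \<le> card (verts G - {v})" using assms(2,3) by simp
  then show ?thesis
    using multigraph_resolve[OF G(1) v t(1)] regular_resolve[OF G(1) v t(1) G(2)] t(2)
    by (simp add: well_connected_def)
qed

section \<open>Expanding the Martin invariant; its vanishing below 2k-edge connectivity\<close>

lemma martin_expand:
  assumes "\<not> has_self_loop G" "4 \<le> card (verts G)"
  obtains v where "v \<in> verts G" "martin G = (\<Sum>\<tau>\<in>transitions G v. martin (resolve G v \<tau>))"
proof -
  have "verts G \<noteq> {}" using assms(2) by auto
  then have "(SOME v. v \<in> verts G) \<in> verts G" by (simp add: some_in_eq)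
  moreover have "martin G = (\<Sum>\<tau>\<in>transitions G (SOME v. v \<in> verts G).
      martin (resolve G (SOME v. v \<in> verts G) \<tau>))"
    using assms by (subst martin.simps) (simp add: Let_def)
  ultimately show thesis by (rule that)
qed

lemma martin_not_conn:
  assumes "multigraph G" "regular (2 * k) G" "2 \<le> card (verts G)" "\<not> conn (2 * k) G"
  shows "martin G = 0"
  using assms
proof (induction "card (verts G)" arbitrary: G rule: less_induct)
  case less
  note G = less.prems
  show ?case
  proof (cases "has_self_loop G")
    case True
    then show ?thesis by (subst martin.simps) simp
  next
    case False
    then have lf: "loop_free_at G v" if "v \<in> verts G" for v
      using that loop_free_iff[OF G(1)] by blast
    then have single: "cutsize G {v} = 2 * k" if "v \<in> verts G" for v
      using degree_loop_free[OF G(1)] G(2) that by (simp add: regular_def)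
    obtain S where S: "S \<noteq> {}" "S \<subset> verts G" "cutsize G S < 2 * k"
      using G(4) by (auto simp: conn_def not_le)
    have fin: "finite (verts G)" "finite S"
      using multigraph_finite(2)[OF G(1)] S(2) by (auto intro: finite_subset)
    have co: "cutsize G (verts G - S) < 2 * k"
      using S cutsize_Diff[OF G(1), of S] by auto
    \<comment> \<open>In a loop-free graph the cut around a single vertex is exactly 2k, so neither
      side of a smaller cut is a singleton. This also provides the four vertices needed for an
      expansion.\<close>
    have ge2: "2 \<le> card T" if "T \<noteq> {}" "T \<subseteq> verts G" "cutsize G T < 2 * k" for T
    proof (rule ccontr)
      have "finite T" using that(2) fin(1) by (rule finite_subset)
      moreover assume "\<not> 2 \<le> card T"
      ultimately have "card T = 1" using that(1) by (cases "card T") auto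
      then obtain v where "T = {v}" by (auto simp: card_1_singleton_iff)
      then show False using single[of v] that by simp
    qed
    have "2 \<le> card S" using S by (intro ge2) auto
    moreover have "2 \<le> card (verts G - S)" using S(2) co by (intro ge2) auto
    moreover have "card (verts G) = card S + card (verts G - S)"
      using S(2) fin by (simp add: card_Diff_subset card_mono psubset_imp_subset)
    ultimately have 4: "4 \<le> card (verts G)" by simp
    obtain v where v: "v \<in> verts G" "martin G = (\<Sum>\<tau>\<in>transitions G v. martin (resolve G v \<tau>))"
      using martin_expand[OF False 4] .
    \<comment> \<open>The side of the small cut that avoids \<open>v\<close>. The other side has a
      second vertex, so this one is still a proper subset once \<open>v\<close> is removed.\<close>
    obtain T where T: "T \<noteq> {}" "T \<subset> verts G - {v}" "cutsize G T < 2 * k"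
    proof (cases "v \<in> S")
      case True
      have "S \<noteq> {v}" using \<open>2 \<le> card S\<close> by auto
      then have "verts G - S \<subset> verts G - {v}" using True S(2) by auto
      then show thesis using that[of "verts G - S"] S(2) co by auto
    next
      case v: False
      have "verts G - S \<noteq> {v}" using \<open>2 \<le> card (verts G - S)\<close> by auto
      then have "S \<subset> verts G - {v}" using v \<open>v \<in> verts G\<close> S(2) by auto
      then show thesis using that S(1,3) by blast
    qed
    have "martin (resolve G v \<tau>) = 0" if t: "\<tau> \<in> transitions G v" for \<tau>
    proof (rule less.hyps)
      show "card (verts (resolve G v \<tau>)) < card (verts G)" "2 \<le> card (verts (resolve G v \<tau>))"
        using v(1) fin 4 by (auto simp: card_gt_0_iff)
      show "multigraph (resolve G v \<tau>)" "regular (2 * k) (resolve G v \<tau>)"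
        using multigraph_resolve[OF G(1) lf[OF v(1)] t] regular_resolve[OF G(1) lf[OF v(1)] t G(2)] .
      have "v \<notin> T" using T(2) by auto
      then have "cutsize (resolve G v \<tau>) T < 2 * k"
        using cutsize_resolve[OF G(1) lf[OF v(1)] t, of T] T(3) by linarith
      then show "\<not> conn (2 * k) (resolve G v \<tau>)"
        using T(1,2) by (auto simp: conn_def not_le)
    qed
    then show ?thesis by (simp add: v(2))
  qed
qed

section \<open>Sides of a cut\<close>

lemma verts_cut_side [simp]: "verts (cut_side G X z) = insert z X"
  by (simp add: cut_side_def)

lemma multigraph_cut_side:
  assumes "multigraph G" "X \<subseteq> verts G"
  shows "multigraph (cut_side G X z)"
proof -
  have "edges (cut_side G X z) \<subseteq> edges G" by (auto simp: cut_side_def edge_cut_def)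
  moreover from this have "disjoint (edges (cut_side G X z))"
    using assms(1) by (auto simp: multigraph_def intro: pairwise_subset)
  moreover have "finite X" using assms by (auto simp: multigraph_def intro: finite_subset)
  ultimately show ?thesis
    using assms(1) by (auto simp: multigraph_def cut_side_def intro: finite_subset)
qed

lemma vert_cut_side_meets:
  assumes "z \<notin> X" "S \<subseteq> X"
  shows "vert (cut_side G X z) ` e \<inter> S \<noteq> {} \<longleftrightarrow> vert G ` e \<inter> S \<noteq> {}"
  using assms by (auto simp: cut_side_def split: if_splits)

lemma crossing_cut_side:
  assumes "z \<notin> X" "S \<subseteq> X"
  shows "crossing (cut_side G X z) S e \<longleftrightarrow> crossing G S e"
proof -
  have "vert (cut_side G X z) h \<in> S \<longleftrightarrow> vert G h \<in> S" for h
    using assms by (auto simp: cut_side_def)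
  then show ?thesis by (auto simp: crossing_def)
qed

lemma edges_cut_side:
  assumes "multigraph G" "X \<subseteq> verts G"
  shows "edges (cut_side G X z) = {e \<in> edges G. vert G ` e \<inter> X \<noteq> {}}"
proof -
  have "e \<in> edges (cut_side G X z) \<longleftrightarrow> vert G ` e \<inter> X \<noteq> {}" if "e \<in> edges G" for e
    using assms(1) that
    by (rule multigraph_edge) (use assms(2) that in \<open>auto simp: cut_side_def edge_cut_def\<close>)
  moreover have "edges (cut_side G X z) \<subseteq> edges G" by (auto simp: cut_side_def edge_cut_def)
  ultimately show ?thesis by auto
qed

lemma cutsize_cut_side:
  assumes "multigraph G" "X \<subseteq> verts G" "z \<notin> X" "S \<subseteq> X"
  shows "cutsize (cut_side G X z) S = cutsize G S"
proof -
  have "{e \<in> edges (cut_side G X z). crossing (cut_side G X z) S e} = {e \<in> edges G. crossing G S e}"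
    using assms(4) unfolding edges_cut_side[OF assms(1,2)] crossing_cut_side[OF assms(3,4)]
    by (auto simp: crossing_def)
  then show ?thesis by (simp add: cutsize_def)
qed

text \<open>A set containing \<open>z\<close> has the cut of its complement, which lies in
  \<open>X\<close>; so every cut of the side is a cut of \<open>G\<close>, and the one around
  \<open>z\<close> is 2k by tightness. There is no loop at \<open>z\<close>, because every edge kept
  meets \<open>X\<close>.\<close>

lemma well_connected_cut_side:
  assumes "well_connected k G" "X \<noteq> {}" "X \<subset> verts G" "cutsize G X = 2 * k" "z \<notin> X"
  shows "well_connected k (cut_side G X z)"
proof -
  let ?H = "cut_side G X z"
  have G: "multigraph G" using assms(1) by (simp add: well_connected_def)
  have X: "X \<subseteq> verts G" "finite X"
    using assms(3) multigraph_finite(2)[OF G] by (auto intro: finite_subset)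
  have H: "multigraph ?H" by (rule multigraph_cut_side[OF G X(1)])
  have c: "cutsize ?H S = cutsize G S" if "S \<subseteq> X" for S
    using cutsize_cut_side[OF G X(1) assms(5) that] .
  have c': "cutsize ?H S = cutsize G (X - S)" if "S \<subseteq> insert z X" "z \<in> S" for S
  proof -
    have "insert z X - S = X - S" using that by auto
    then show ?thesis using cutsize_Diff[OF H, of S] that c[of "X - S"] by auto
  qed
  have "conn (2 * k) ?H"
    unfolding conn_def
  proof (intro allI impI)
    fix S assume S: "S \<noteq> {}" "S \<subset> verts ?H"
    show "2 * k \<le> cutsize ?H S"
    proof (cases "z \<in> S")
      case True
      then have "X - S \<noteq> {}" "X - S \<subset> verts G" using S assms(3) by auto
      then show ?thesis using c'[of S] S(2) True well_connected_conn[OF assms(1)] by simp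
    next
      case False
      then have "S \<subseteq> X" using S(2) by auto
      moreover from this have "S \<subset> verts G" using assms(3) by auto
      ultimately show ?thesis using c[of S] S(1) well_connected_conn[OF assms(1)] by simp
    qed
  qed
  moreover have "regular (2 * k) ?H"
    unfolding regular_def
  proof
    fix x assume x: "x \<in> verts ?H"
    have "vert ?H ` e \<noteq> {x}" if e: "e \<in> edges ?H" for e
    proof (cases "x = z")
      case True
      have "vert G ` e \<inter> X \<noteq> {}" using e unfolding edges_cut_side[OF G X(1)] by simp
      then have "vert ?H ` e \<inter> X \<noteq> {}"
        using vert_cut_side_meets[OF assms(5) order_refl, of G e] by simp
      then show ?thesis using True assms(5) by (metis Int_insert_left_if0 inf_bot_left)
    next
      case False
      then have "loop_free_at G x" using x X(1) by (intro well_connected_vertex(1)[OF assms(1)]) auto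
      then have "vert G ` e \<noteq> {x}" using e unfolding edges_cut_side[OF G X(1)] by (simp add: loop_free_at_def)
      moreover have "vert G h = x" if "vert ?H h = x" for h
        using that False by (auto simp: cut_side_def split: if_splits)
      then have "vert G ` e = {x}" if "vert ?H ` e = {x}"
        using that by (metis image_cong image_eqI singletonD)
      ultimately show ?thesis by blast
    qed
    then have "degree ?H x = cutsize ?H {x}"
      by (intro degree_loop_free[OF H]) (simp add: loop_free_at_def)
    also have "\<dots> = 2 * k"
    proof (cases "x = z")
      case True
      then show ?thesis using c'[of "{z}"] assms(4,5) by simp
    next
      case False
      then have "x \<in> X" using x by simp
      then show ?thesis using c[of "{x}"] well_connected_vertex(2)[OF assms(1)] X(1) by auto
    qed
    finally show "degree ?H x = 2 * k" .
  qed
  moreover have "2 \<le> card (verts ?H)"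
    using assms(2,5) X(2) by (simp add: card_gt_0_iff Suc_le_eq)
  ultimately show ?thesis using H by (simp add: well_connected_def)
qed

section \<open>Total decomposability\<close>

text \<open>Forgets the list of pieces. A non-trivial cut needs four vertices, so
  \<open>decomposition\<close> always stops at a graph with three.\<close>

inductive decomposes :: "nat \<Rightarrow> ('v, 'h) graph \<Rightarrow> bool" for k where
  three: "card (verts G) = 3 \<Longrightarrow> decomposes k G"
| cut: "nontrivial_cut k G X Y \<Longrightarrow> x \<in> X \<Longrightarrow> y \<in> Y \<Longrightarrow>
    decomposes k (cut_side G X y) \<Longrightarrow> decomposes k (cut_side G Y x) \<Longrightarrow> decomposes k G"

lemma nontrivial_cut_card:
  assumes "nontrivial_cut k G X Y"
  shows "4 \<le> card (verts G)" "card (verts G) = card X + card Y" "finite (verts G)"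
proof -
  have "finite X" "finite Y" "2 \<le> card X" "2 \<le> card Y" "X \<union> Y = verts G" "X \<inter> Y = {}"
    using assms by (auto simp: nontrivial_cut_def bipartition_def intro: card_ge_0_finite)
  then show "card (verts G) = card X + card Y" "4 \<le> card (verts G)" "finite (verts G)"
    using card_Un_disjoint[of X Y] by auto
qed

lemma nontrivial_cut_iff:
  assumes "multigraph G"
  shows "nontrivial_cut k G X Y \<longleftrightarrow>
    X \<subseteq> verts G \<and> Y = verts G - X \<and> 2 \<le> card X \<and> 2 \<le> card Y \<and> cutsize G X = 2 * k"
proof -
  have "bipartition G X Y \<longleftrightarrow> X \<subseteq> verts G \<and> Y = verts G - X" if "2 \<le> card X" "2 \<le> card Y"
    using that by (auto simp: bipartition_def)
  then show ?thesis
    unfolding nontrivial_cut_def using cutsize_eq_edge_cut[OF assms, of X Y] by metis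
qed

lemma nontrivial_cut_commute:
  assumes "multigraph G" "nontrivial_cut k G X Y"
  shows "nontrivial_cut k G Y X"
  using assms cutsize_Diff[OF assms(1), of X] double_diff[of X "verts G" "verts G"]
  unfolding nontrivial_cut_iff[OF assms(1)] by auto

lemma decomposes_iff_decomposition:
  "decomposes k G \<longleftrightarrow> (\<exists>Gs. decomposition k G Gs \<and> (\<forall>H\<in>set Gs. card (verts H) = 3))"
proof
  assume "decomposes k G"
  then show "\<exists>Gs. decomposition k G Gs \<and> (\<forall>H\<in>set Gs. card (verts H) = 3)"
  proof induction
    case (three G)
    then have "\<nexists>X Y. nontrivial_cut k G X Y" using nontrivial_cut_card(1) by fastforce
    then show ?case using three by (intro exI[of _ "[G]"]) (simp add: decomposition.stop)
  next
    case (cut G X Y x y)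
    then obtain Gs Hs where "decomposition k (cut_side G X y) Gs" "\<forall>H\<in>set Gs. card (verts H) = 3"
      "decomposition k (cut_side G Y x) Hs" "\<forall>H\<in>set Hs. card (verts H) = 3" by blast
    then show ?case using cut.hyps
      by (intro exI[of _ "Gs @ Hs"]) (auto intro: decomposition.split)
  qed
next
  have "decomposes k G" if "decomposition k G Gs" "\<forall>H\<in>set Gs. card (verts H) = 3" for Gs
    using that by (induction rule: decomposition.induct) (auto intro: decomposes.intros)
  then show "\<exists>Gs. decomposition k G Gs \<and> (\<forall>H\<in>set Gs. card (verts H) = 3) \<Longrightarrow> decomposes k G" by blast
qed

text \<open>
  Total decomposability only depends on cut sizes, so that isomorphisms on the level of half-edges
  can be avoided.
\<close>

definition cut_iso :: "('v \<Rightarrow> 'v) \<Rightarrow> ('v, 'h) graph \<Rightarrow> ('v, 'h) graph \<Rightarrow> bool" where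
  "cut_iso g G H \<longleftrightarrow> bij_betw g (verts G) (verts H) \<and>
     (\<forall>S. S \<subseteq> verts G \<longrightarrow> cutsize H (g ` S) = cutsize G S)"

text \<open>Of a set and its complement, it suffices to consider the one that avoids a fixed vertex \<open>z\<close>.\<close>

lemma cut_isoI:
  assumes "multigraph G" "multigraph H" "bij_betw g (verts G) (verts H)" "z \<in> verts G"
    and "\<And>S. S \<subseteq> verts G - {z} \<Longrightarrow> cutsize H (g ` S) = cutsize G S"
  shows "cut_iso g G H"
  unfolding cut_iso_def
proof (intro conjI allI impI)
  fix S assume S: "S \<subseteq> verts G"
  show "cutsize H (g ` S) = cutsize G S"
  proof (cases "z \<in> S")
    case True
    have inj: "inj_on g (verts G)" and im: "g ` verts G = verts H"
      using assms(3) by (auto simp: bij_betw_def)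
    have "cutsize H (g ` S) = cutsize H (verts H - g ` S)"
      using S im by (intro cutsize_Diff[OF assms(2), symmetric]) auto
    also have "verts H - g ` S = g ` (verts G - S)"
      using inj_on_image_set_diff[OF inj, of "verts G" S] S im by auto
    also have "cutsize H \<dots> = cutsize G (verts G - S)"
      using True by (intro assms(5)) auto
    also have "\<dots> = cutsize G S" by (rule cutsize_Diff[OF assms(1) S])
    finally show ?thesis .
  next
    case False
    then show ?thesis using S by (intro assms(5)) auto
  qed
qed (rule assms(3))

lemma cut_iso_cut_side:
  assumes "multigraph G" "multigraph H" "cut_iso g G H" "X \<subseteq> verts G" "z \<in> verts G" "z \<notin> X"
  shows "cut_iso g (cut_side G X z) (cut_side H (g ` X) (g z))"
proof (rule cut_isoI[where z = z])
  have inj: "inj_on g (verts G)" and im: "g ` verts G = verts H"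
    and c: "\<And>S. S \<subseteq> verts G \<Longrightarrow> cutsize H (g ` S) = cutsize G S"
    using assms(3) by (auto simp: cut_iso_def bij_betw_def)
  have gX: "g ` X \<subseteq> verts H" using im assms(4) by auto
  show "multigraph (cut_side G X z)" "multigraph (cut_side H (g ` X) (g z))"
    using multigraph_cut_side[OF assms(1,4)] multigraph_cut_side[OF assms(2) gX] .
  show "bij_betw g (verts (cut_side G X z)) (verts (cut_side H (g ` X) (g z)))"
    using inj_on_subset[OF inj, of "insert z X"] assms(4,5) by (simp add: bij_betw_def)
  have gz: "g z \<notin> g ` X"
    using inj_on_image_mem_iff[OF inj assms(5,4)] assms(6) by simp
  fix S assume "S \<subseteq> verts (cut_side G X z) - {z}"
  then have S: "S \<subseteq> X" by auto
  then have "cutsize (cut_side H (g ` X) (g z)) (g ` S) = cutsize H (g ` S)"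
    by (intro cutsize_cut_side[OF assms(2) gX gz]) auto
  also have "\<dots> = cutsize G S" using S assms(4) by (intro c) auto
  also have "\<dots> = cutsize (cut_side G X z) S"
    using cutsize_cut_side[OF assms(1,4,6) S] by simp
  finally show "cutsize (cut_side H (g ` X) (g z)) (g ` S) = cutsize (cut_side G X z) S" .
qed simp

text \<open>The rules look only at vertex counts and cut sizes, and the sides of corresponding cuts
  are again related by \<open>cut_iso\<close>.\<close>

lemma decomposes_cut_iso:
  assumes "decomposes k G" "multigraph G" "multigraph H" "cut_iso g G H"
  shows "decomposes k H"
  using assms
proof (induction arbitrary: H rule: decomposes.induct)
  case (three G)
  then have "card (verts H) = 3" by (auto simp: cut_iso_def dest: bij_betw_same_card)
  then show ?case by (rule decomposes.three)
next
  case (cut G X Y x y)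
  note G = cut.prems(1) and H = cut.prems(2)
  have inj: "inj_on g (verts G)" and im: "g ` verts G = verts H"
    and c: "\<And>S. S \<subseteq> verts G \<Longrightarrow> cutsize H (g ` S) = cutsize G S"
    using cut.prems(3) by (auto simp: cut_iso_def bij_betw_def)
  have XY: "X \<subseteq> verts G" "Y = verts G - X" "2 \<le> card X" "2 \<le> card Y" "cutsize G X = 2 * k"
    using cut.hyps(1) by (auto simp: nontrivial_cut_iff[OF G])
  have Y: "Y \<subseteq> verts G" using XY(2) by auto
  have xy: "x \<in> verts G" "y \<in> verts G" "x \<notin> Y" "y \<notin> X" using XY(1,2) cut.hyps(2,3) by auto
  have "card (g ` X) = card X" "card (g ` Y) = card Y"
    using inj XY(1) Y by (auto intro!: card_image intro: inj_on_subset)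
  moreover have "g ` Y = verts H - g ` X"
    using inj_on_image_set_diff[OF inj, of "verts G" X] XY(1,2) im by auto
  ultimately have "nontrivial_cut k H (g ` X) (g ` Y)"
    using XY image_mono[OF XY(1), of g] im c[OF XY(1)] unfolding nontrivial_cut_iff[OF H] by simp
  moreover have "decomposes k (cut_side H (g ` X) (g y))"
    using cut.IH(1) multigraph_cut_side[OF G XY(1)] multigraph_cut_side[OF H, of "g ` X"]
      cut_iso_cut_side[OF G H cut.prems(3) XY(1) xy(2,4)] XY(1) im by blast
  moreover have "decomposes k (cut_side H (g ` Y) (g x))"
    using cut.IH(2) multigraph_cut_side[OF G Y] multigraph_cut_side[OF H, of "g ` Y"]
      cut_iso_cut_side[OF G H cut.prems(3) Y xy(1,3)] Y im by blast
  ultimately show ?case using cut.hyps(2,3) by (intro decomposes.cut[of k H _ _ "g x" "g y"]) auto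
qed

text \<open>The form in which graphs before and after resolving are compared. The single vertex
  outside \<open>A\<close> may change its name, and sets containing it are handled through their
  complements, which lie in \<open>A\<close>.\<close>

lemma decomposes_rename_vertex:
  fixes G H :: "('v, 'h) graph"
  assumes "multigraph G" "multigraph H" "verts G = insert z A" "verts H = insert z' A" "z \<notin> A" "z' \<notin> A"
    and "\<And>S. S \<subseteq> A \<Longrightarrow> cutsize G S = cutsize H S" "decomposes k G"
  shows "decomposes k H"
proof -
  define g where "g = (\<lambda>x. if x = z then z' else x)"
  have g: "g ` S = S" if "S \<subseteq> A" for S
    using that assms(5) by (auto simp: g_def image_iff)
  have "bij_betw g (verts G) (verts H)"
    using assms(3-6) by (auto simp: bij_betw_def inj_on_def g_def)
  then have "cut_iso g G H"
  proof (rule cut_isoI[OF assms(1,2)])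
    fix S assume "S \<subseteq> verts G - {z}"
    then have "S \<subseteq> A" using assms(3) by auto
    then show "cutsize H (g ` S) = cutsize G S" using g assms(7) by simp
  qed (simp add: assms(3))
  then show ?thesis by (rule decomposes_cut_iso[OF assms(8,1,2)])
qed

lemma decomposes_cong:
  fixes G H :: "('v, 'h) graph"
  assumes "multigraph G" "multigraph H" "verts G = insert z A" "verts H = insert z' A" "z \<notin> A" "z' \<notin> A"
    and "\<And>S. S \<subseteq> A \<Longrightarrow> cutsize G S = cutsize H S"
  shows "decomposes k G \<longleftrightarrow> decomposes k H"
  using decomposes_rename_vertex[OF assms] decomposes_rename_vertex[OF assms(2,1,4,3,6,5) assms(7)[symmetric]] by blast

section \<open>Transitions at a vertex on one side of a tight cut\<close>

text \<open>\<open>cut_side\<close> reattaches half-edges but keeps edges as sets of half-edges, so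
  the edges at \<open>v\<close>, and with them the transitions, are literally the same.\<close>

lemma transitions_cut_side:
  assumes "multigraph G" "X \<subseteq> verts G" "z \<notin> X" "v \<in> X"
  shows "transitions (cut_side G X z) v = transitions G v"
proof -
  have "v \<in> vert (cut_side G X z) ` e \<longleftrightarrow> v \<in> vert G ` e" for e
    using vert_cut_side_meets[OF assms(3), of "{v}" G e] assms(4) by simp
  then have "incident (cut_side G X z) v = incident G v"
    using assms(4) by (auto simp: incident_def edges_cut_side[OF assms(1,2)])
  then show ?thesis by (simp add: transitions_def)
qed

text \<open>\<open>v\<close> is the vertex to be expanded; \<open>y\<close> doubles as the name of
  the vertex that replaces \<open>Y\<close> in the side \<open>H\<close>.\<close>

locale tight_side =
  fixes k :: nat and G :: "('v, 'h) graph" and X Y :: "'v set" and v y :: 'v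
  assumes wc: "well_connected k G" and XV: "X \<subseteq> verts G" and Y: "Y = verts G - X"
    and X2: "2 \<le> card X" and vX: "v \<in> X" and yY: "y \<in> Y" and tight: "cutsize G X = 2 * k"
begin

abbreviation "H \<equiv> cut_side G X y"
abbreviation "X' \<equiv> X - {v}"

lemma mg: "multigraph G" using wc by (simp add: well_connected_def)

lemma v: "v \<in> verts G" using XV vX by auto

lemma lf: "loop_free_at G v" by (rule well_connected_vertex(1)[OF wc v])

lemma yX: "y \<notin> X" using yY Y by simp

lemma X'_ne: "X' \<noteq> {}"
proof
  assume "X' = {}"
  then have "X = {v}" using vX by auto
  then show False using X2 by simp
qed

lemma wcH: "well_connected k H"
  using XV yY Y tight yX vX by (intro well_connected_cut_side[OF wc]) auto

lemma tightY: "cutsize G Y = 2 * k"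
  using cutsize_Diff[OF mg XV] tight Y by simp

lemma transH: "transitions H v = transitions G v"
  by (rule transitions_cut_side[OF mg XV yX vX])

lemma cutsize_resolve_H:
  assumes "\<tau> \<in> transitions G v" "S \<subseteq> X'"
  shows "cutsize (resolve H v \<tau>) S = cutsize (resolve G v \<tau>) S"
proof -
  have S: "S \<subseteq> X" "v \<notin> S" using assms(2) by auto
  have "multigraph H" "loop_free_at H v"
    using wcH well_connected_vertex(1)[OF wcH] vX by (auto simp: well_connected_def)
  from cutsize_resolve[OF this _ S(2), of \<tau>] cutsize_resolve[OF mg lf assms(1) S(2)]
  show ?thesis
    using assms(1) cutsize_cut_side[OF mg XV yX S(1)]
    by (simp add: transH vert_cut_side_meets[OF yX S(1)])
qed

text \<open>If the cut of \<open>Y\<close> does not fall below 2k, it has lost nothing, so no pair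
  consists of two edges into \<open>Y\<close>. Then a subset of \<open>Y\<close> loses nothing
  either.\<close>

lemma cutsize_resolve_Y:
  assumes "\<tau> \<in> transitions G v" "2 * k \<le> cutsize (resolve G v \<tau>) Y" "S \<subseteq> Y"
  shows "cutsize (resolve G v \<tau>) S = cutsize G S"
proof -
  have vY: "v \<notin> Y" using Y vX by simp
  let ?c = "\<lambda>S. {p \<in> \<tau>. \<forall>e\<in>p. vert G ` e \<inter> S \<noteq> {}}"
  have "finite (?c Y)"
    using finite_pairing(1)[OF mg transitions_pairing(1)[OF assms(1)]] by simp
  moreover have "card (?c Y) = 0"
    using cutsize_resolve[OF mg lf assms(1) vY] assms(2) tightY by linarith
  ultimately have "?c Y = {}" by (simp only: card_0_eq)
  moreover have "?c S \<subseteq> ?c Y" using assms(3) by blast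
  ultimately have "?c S = {}" by blast
  then have "card (?c S) = 0" by (simp only: card.empty)
  moreover have "v \<notin> S" using vY assms(3) by auto
  ultimately show ?thesis using cutsize_resolve[OF mg lf assms(1), of S] by linarith
qed

lemma conn_resolve_Y:
  assumes "conn (2 * k) (resolve G v \<tau>)"
  shows "2 * k \<le> cutsize (resolve G v \<tau>) Y"
proof -
  have "Y \<noteq> {}" "Y \<subset> verts G - {v}" using yY Y X'_ne XV vX by auto
  then show ?thesis using assms by (simp add: conn_def)
qed

text \<open>From \<open>G\<close> to \<open>H\<close>, complements reduce everything to subsets of
  \<open>X'\<close>. Conversely, sets inside \<open>X'\<close> are controlled by \<open>H\<close>,
  sets inside \<open>Y\<close> by \<open>G\<close>, and the others are uncrossed with
  \<open>X'\<close>, which stays tight.\<close>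

lemma conn_resolve_H_iff:
  assumes "\<tau> \<in> transitions G v"
  shows "conn (2 * k) (resolve H v \<tau>) \<longleftrightarrow> conn (2 * k) (resolve G v \<tau>)"
proof
  assume R: "conn (2 * k) (resolve G v \<tau>)"
  have le: "2 * k \<le> cutsize (resolve H v \<tau>) S" if "S \<noteq> {}" "S \<subseteq> X'" for S
  proof -
    have "S \<subset> verts G - {v}" using that(2) XV yY Y vX by auto
    then show ?thesis using R that(1) cutsize_resolve_H[OF assms that(2)] by (simp add: conn_def)
  qed
  have mgH: "multigraph (resolve H v \<tau>)"
    using wcH well_connected_vertex(1)[OF wcH] vX transH assms
    by (intro multigraph_resolve) (auto simp: well_connected_def)
  show "conn (2 * k) (resolve H v \<tau>)"
    unfolding conn_def
  proof (intro allI impI)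
    fix S assume S: "S \<noteq> {}" "S \<subset> verts (resolve H v \<tau>)"
    show "2 * k \<le> cutsize (resolve H v \<tau>) S"
    proof (cases "y \<in> S")
      case True
      then have "verts (resolve H v \<tau>) - S \<noteq> {}" "verts (resolve H v \<tau>) - S \<subseteq> X'"
        using S by auto
      then have "2 * k \<le> cutsize (resolve H v \<tau>) (verts (resolve H v \<tau>) - S)" by (rule le)
      then show ?thesis using cutsize_Diff[OF mgH, of S] S(2) by simp
    next
      case False
      then show ?thesis using S by (intro le) auto
    qed
  qed
next
  assume L: "conn (2 * k) (resolve H v \<tau>)"
  let ?d = "cutsize (resolve G v \<tau>)"
  let ?W = "verts G - {v}"
  have mgR: "multigraph (resolve G v \<tau>)" by (rule multigraph_resolve[OF mg lf assms])
  have co: "?d (?W - S) = ?d S" if "S \<subseteq> ?W" for S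
    using cutsize_Diff[OF mgR, of S] that by simp
  have X'W: "X' \<subseteq> ?W" and YW: "Y \<subseteq> ?W" and WX': "?W - X' = Y" using XV Y vX by auto
  have inX: "2 * k \<le> ?d S" if "S \<noteq> {}" "S \<subseteq> X'" for S
  proof -
    have "S \<subset> verts (resolve H v \<tau>)" using that(2) yX yY vX by auto
    then have "2 * k \<le> cutsize (resolve H v \<tau>) S" by (rule L[unfolded conn_def, rule_format, OF that(1)])
    then show ?thesis by (simp only: cutsize_resolve_H[OF assms that(2)])
  qed
  \<comment> \<open>\<open>Y\<close> is the complement of \<open>X'\<close> once \<open>v\<close> is
    gone, so connectivity on the \<open>H\<close> side already keeps the cut of \<open>Y\<close>
    from shrinking.\<close>
  have dY: "2 * k \<le> ?d Y"
    using inX[OF X'_ne order_refl] co[OF X'W] WX' by simp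
  note inY' = cutsize_resolve_Y[OF assms dY]
  have inY: "2 * k \<le> ?d S" if "S \<noteq> {}" "S \<subseteq> Y" for S
  proof -
    have "S \<subset> verts G" using that(2) Y vX v by auto
    then show ?thesis using inY'[OF that(2)] well_connected_conn[OF wc that(1)] by simp
  qed
  have dX': "?d X' = 2 * k"
    using co[OF X'W] WX' inY'[OF order_refl] tightY by simp
  show "conn (2 * k) (resolve G v \<tau>)"
    unfolding conn_def
  proof (intro allI impI)
    fix A assume A: "A \<noteq> {}" "A \<subset> verts (resolve G v \<tau>)"
    then have AW: "A \<subset> ?W" by simp
    have B: "?W - A \<noteq> {}" using AW by auto
    have dB: "?d (?W - A) = ?d A" using AW by (intro co) auto
    consider "A \<inter> X' = {}" | "X' \<subseteq> A" | "Y \<subseteq> A" | "A \<inter> X' \<noteq> {}" "\<not> X' \<subseteq> A" "\<not> Y \<subseteq> A" by blast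
    then show "2 * k \<le> ?d A"
    proof cases
      case 1
      then show ?thesis using A(1) AW WX' by (intro inY) auto
    next
      case 2
      then have "2 * k \<le> ?d (?W - A)" using B WX' by (intro inY) auto
      then show ?thesis using dB by simp
    next
      case 3
      then have "2 * k \<le> ?d (?W - A)" using B WX' by (intro inX) auto
      then show ?thesis using dB by simp
    next
      case 4
      have "2 * k \<le> ?d (?W - (A \<union> X'))" using 4 WX' by (intro inY) auto
      then have "2 * k \<le> ?d (A \<union> X')" using co[of "A \<union> X'"] AW X'W by auto
      moreover have "2 * k \<le> ?d (A \<inter> X')" using 4 by (intro inX) auto
      moreover have "?d (A \<inter> X') + ?d (A \<union> X') \<le> ?d A + ?d X'" by (rule cutsize_submod[OF mgR])
      ultimately show ?thesis using dX' by simp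
    qed
  qed
qed

lemma good_H: "good (2 * k) H v = good (2 * k) G v"
  using conn_resolve_H_iff by (auto simp: good_def transH)

text \<open>Allows a statement about \<open>cut_side G Y x\<close>, which is independent of the
  transition, to be extracted from a quantifier over good transitions.\<close>

lemma good_ne: "good (2 * k) G v \<noteq> {}"
  using fact_le_card_good[OF wc v] by (metis card.empty fact_ge_1 not_one_le_zero order_trans)

lemma goodD:
  assumes "\<tau> \<in> good (2 * k) G v"
  shows "\<tau> \<in> transitions G v" "multigraph (resolve G v \<tau>)" "multigraph (resolve H v \<tau>)"
    "\<And>S. S \<subseteq> Y \<Longrightarrow> cutsize (resolve G v \<tau>) S = cutsize G S"
proof -
  show t: "\<tau> \<in> transitions G v" using assms by (simp add: good_def)
  show "multigraph (resolve G v \<tau>)" by (rule multigraph_resolve[OF mg lf t])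
  show "multigraph (resolve H v \<tau>)"
    using wcH well_connected_vertex(1)[OF wcH] vX transH t
    by (intro multigraph_resolve) (auto simp: well_connected_def)
  show "\<And>S. S \<subseteq> Y \<Longrightarrow> cutsize (resolve G v \<tau>) S = cutsize G S"
    using assms by (intro cutsize_resolve_Y[OF t conn_resolve_Y]) (auto simp: good_def)
qed

lemma YV: "Y \<subseteq> verts G" using Y by auto

lemma nontrivial_cut_resolve:
  assumes "\<tau> \<in> good (2 * k) G v" "3 \<le> card X" "2 \<le> card Y"
  shows "nontrivial_cut k (resolve G v \<tau>) X' Y"
  unfolding nontrivial_cut_iff[OF goodD(2)[OF assms(1)]]
proof (intro conjI)
  have "cutsize (resolve G v \<tau>) (verts (resolve G v \<tau>) - X') = cutsize (resolve G v \<tau>) X'"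
    using XV by (intro cutsize_Diff[OF goodD(2)[OF assms(1)]]) auto
  moreover have "verts (resolve G v \<tau>) - X' = Y" using Y vX by auto
  ultimately show "cutsize (resolve G v \<tau>) X' = 2 * k"
    using goodD(4)[OF assms(1) order_refl] tightY by simp
qed (use XV Y vX assms(2,3) in auto)

text \<open>Cutting and resolving commute as far as cut sizes inside \<open>X'\<close> can tell, and
  these are all that matters for \<open>decomposes\<close>.\<close>

lemma decomposes_side_X':
  assumes "\<tau> \<in> good (2 * k) G v"
  shows "decomposes k (cut_side (resolve G v \<tau>) X' y) \<longleftrightarrow> decomposes k (resolve H v \<tau>)"
proof (rule decomposes_cong[where A = X' and z = y and z' = y])
  have X': "X' \<subseteq> verts (resolve G v \<tau>)" using XV by auto
  show "multigraph (cut_side (resolve G v \<tau>) X' y)"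
    by (rule multigraph_cut_side[OF goodD(2)[OF assms] X'])
  show "multigraph (resolve H v \<tau>)" by (rule goodD(3)[OF assms])
  show "cutsize (cut_side (resolve G v \<tau>) X' y) S = cutsize (resolve H v \<tau>) S" if "S \<subseteq> X'" for S
    using cutsize_cut_side[OF goodD(2)[OF assms] X' _ that, of y] yX
      cutsize_resolve_H[OF goodD(1)[OF assms] that] by simp
qed (use yX vX in auto)

lemma decomposes_side_Y:
  assumes "\<tau> \<in> good (2 * k) G v" "x \<in> X" "x' \<in> X'"
  shows "decomposes k (cut_side (resolve G v \<tau>) Y x') \<longleftrightarrow> decomposes k (cut_side G Y x)"
proof (rule decomposes_cong[where A = Y and z = x' and z' = x])
  have Y': "Y \<subseteq> verts (resolve G v \<tau>)" using Y vX by auto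
  show "multigraph (cut_side (resolve G v \<tau>) Y x')"
    by (rule multigraph_cut_side[OF goodD(2)[OF assms(1)] Y'])
  show "multigraph (cut_side G Y x)" by (rule multigraph_cut_side[OF mg YV])
  have x: "x \<notin> Y" "x' \<notin> Y" using Y assms(2,3) by auto
  show "x' \<notin> Y" "x \<notin> Y" by (fact x)+
  show "cutsize (cut_side (resolve G v \<tau>) Y x') S = cutsize (cut_side G Y x) S" if "S \<subseteq> Y" for S
    using cutsize_cut_side[OF goodD(2)[OF assms(1)] Y' x(2) that]
      cutsize_cut_side[OF mg YV x(1) that] goodD(4)[OF assms(1) that] by simp
qed auto

text \<open>Once \<open>v\<close> is gone, \<open>u\<close> is all that remains of \<open>X\<close>;
  it takes the part of the vertex that replaces \<open>X\<close> in the \<open>Y\<close>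
  side.\<close>

lemma decomposes_resolve_two:
  assumes "\<tau> \<in> good (2 * k) G v" "x \<in> X" "X = {v, u}" "u \<noteq> v"
  shows "decomposes k (resolve G v \<tau>) \<longleftrightarrow> decomposes k (cut_side G Y x)"
proof (rule decomposes_cong[where A = Y and z = u and z' = x])
  show "multigraph (resolve G v \<tau>)" by (rule goodD(2)[OF assms(1)])
  show "multigraph (cut_side G Y x)" by (rule multigraph_cut_side[OF mg YV])
  have x: "x \<notin> Y" "u \<notin> Y" using Y assms(2,3) by auto
  show "u \<notin> Y" "x \<notin> Y" by (fact x)+
  show "verts (resolve G v \<tau>) = insert u Y" using Y XV assms(3,4) by auto
  show "cutsize (resolve G v \<tau>) S = cutsize (cut_side G Y x) S" if "S \<subseteq> Y" for S
    using cutsize_cut_side[OF mg YV x(1) that] goodD(4)[OF assms(1) that] by simp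
qed auto

end

section \<open>Bounds for the number of good transitions\<close>

text \<open>For disjoint \<open>P\<close> and \<open>Q\<close>, the perfect matchings between them,
  written as partitions so that transitions can be members.\<close>

definition cross_partitions :: "'a set \<Rightarrow> 'a set \<Rightarrow> 'a set set set" where
  "cross_partitions P Q = {\<tau>. partition_on (P \<union> Q) \<tau> \<and> (\<forall>p\<in>\<tau>. \<exists>a\<in>P. \<exists>b\<in>Q. p = {a, b})}"

text \<open>A fixed \<open>e\<close> in \<open>P\<close> has at most \<open>card Q\<close> possible
  partners, and removing its pair leaves a matching of smaller sets.\<close>

lemma card_cross_partitions:
  assumes "finite Q" "finite P" "P \<inter> Q = {}"
  shows "card (cross_partitions P Q) \<le> fact (card Q)"
  using assms
proof (induction "card Q" arbitrary: P Q)
  case 0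
  then have "\<tau> = {}" if "\<tau> \<in> cross_partitions P Q" for \<tau>
    using that by (auto simp: cross_partitions_def)
  then have "cross_partitions P Q \<subseteq> {{}}" by blast
  then have "card (cross_partitions P Q) \<le> card {{} :: 'a set set}" by (intro card_mono) auto
  then show ?case using 0 by simp
next
  case (Suc n)
  show ?case
  proof (cases "P = {}")
    case True
    then have "\<tau> = {}" if "\<tau> \<in> cross_partitions P Q" for \<tau>
      using that by (auto simp: cross_partitions_def)
    then have "cross_partitions P Q \<subseteq> {{}}" by blast
    then have "card (cross_partitions P Q) \<le> card {{} :: 'a set set}" by (intro card_mono) auto
    also have "\<dots> \<le> fact (card Q)" using fact_ge_1[of "card Q", where 'a = nat] by simp
    finally show ?thesis .
  next
    case False
    then obtain e where e: "e \<in> P" by blast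
    let ?F = "\<lambda>f. insert {e, f} ` cross_partitions (P - {e}) (Q - {f})"
    have fin: "finite (cross_partitions A B)" if "finite A" "finite B" for A B :: "'a set"
      using finitely_many_partition_on[of "A \<union> B"] that
      by (auto simp: cross_partitions_def intro: finite_subset[rotated])
    have "cross_partitions P Q \<subseteq> (\<Union>f\<in>Q. ?F f)"
    proof
      fix \<tau> assume t: "\<tau> \<in> cross_partitions P Q"
      then have part: "partition_on (P \<union> Q) \<tau>" and cr: "\<And>p. p \<in> \<tau> \<Longrightarrow> \<exists>a\<in>P. \<exists>b\<in>Q. p = {a, b}"
        by (auto simp: cross_partitions_def)
      have dis: "p \<inter> q = {}" if "p \<in> \<tau>" "q \<in> \<tau>" "p \<noteq> q" for p q
        using that part by (auto simp: partition_on_def dest: disjointD)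
      obtain p where p: "p \<in> \<tau>" "e \<in> p" using part e by (auto simp: partition_on_def)
      then obtain f where f: "f \<in> Q" "p = {e, f}" using cr[OF p(1)] e Suc.prems(3) by auto
      let ?s = "\<tau> - {{e, f}}"
      have "insert {e, f} ?s = \<tau>" using p(1) f(2) by auto
      have avoid: "e \<notin> q \<and> f \<notin> q" if "q \<in> ?s" for q
        using dis[of p q] p(1) f(2) that by auto
      have "\<Union>?s = (P - {e}) \<union> (Q - {f})"
      proof -
        have un: "\<Union>\<tau> = P \<union> Q" using part by (simp add: partition_on_def)
        have "\<Union>?s = \<Union>\<tau> - {e, f}" using avoid by auto
        also have "\<dots> = (P - {e}) \<union> (Q - {f})" using un e f(1) Suc.prems(3) by auto
        finally show ?thesis .
      qed
      then have "partition_on ((P - {e}) \<union> (Q - {f})) ?s"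
        using part by (auto simp: partition_on_def disjoint_def)
      moreover have "\<exists>a\<in>P - {e}. \<exists>b\<in>Q - {f}. q = {a, b}" if "q \<in> ?s" for q
        using cr[of q] avoid[OF that] that by blast
      ultimately have "?s \<in> cross_partitions (P - {e}) (Q - {f})"
        by (simp add: cross_partitions_def)
      from image_eqI[where f = "insert {e, f}", OF \<open>insert {e, f} ?s = \<tau>\<close>[symmetric] this]
      show "\<tau> \<in> (\<Union>f\<in>Q. ?F f)" by (rule UN_I[OF f(1)])
    qed
    then have "card (cross_partitions P Q) \<le> card (\<Union>f\<in>Q. ?F f)"
      using fin Suc.prems by (intro card_mono) auto
    also have "\<dots> \<le> (\<Sum>f\<in>Q. card (?F f))" by (rule card_UN_le[OF Suc.prems(1)])
    also have "\<dots> \<le> (\<Sum>f\<in>Q. fact n)"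
    proof (rule sum_mono)
      fix f assume f: "f \<in> Q"
      have "card (?F f) \<le> card (cross_partitions (P - {e}) (Q - {f}))"
        using fin Suc.prems by (intro card_image_le) auto
      also have "\<dots> \<le> fact (card (Q - {f}))"
        using f Suc.hyps(2) Suc.prems by (intro Suc.hyps(1)) auto
      also have "\<dots> = fact n" using f by (simp flip: Suc.hyps(2))
      finally show "card (?F f) \<le> fact n" .
    qed
    also have "\<dots> = fact (card Q)" by (simp flip: Suc.hyps(2))
    finally show ?thesis .
  qed
qed

text \<open>By tightness, k edges at \<open>v\<close> lead to \<open>u\<close> and k to
  \<open>Y\<close>. A pair of two edges of the same kind would lower the cut of \<open>u\<close> or
  of \<open>Y\<close>, both of which are only 2k.\<close>

lemma (in tight_side) card_good_two:
  assumes "X = {v, u}" "u \<noteq> v"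
  shows "card (good (2 * k) G v) = fact k"
proof (rule antisym)
  show "fact k \<le> card (good (2 * k) G v)" by (rule fact_le_card_good[OF wc v])
  let ?P = "{e \<in> incident G v. vert G ` e \<inter> {u} \<noteq> {}}"
  let ?Q = "incident G v - ?P"
  have fin: "finite (incident G v)" by (rule finite_incident[OF mg])
  have u: "u \<in> verts G" using XV assms(1) by auto
  have "{v} \<inter> {u} = {}" using assms(2) by simp
  from cutsize_Un_disjoint[OF mg this] have
    "4 * k = cutsize G X + 2 * card {e \<in> edges G. vert G ` e \<inter> {v} \<noteq> {} \<and> vert G ` e \<inter> {u} \<noteq> {}}"
    using well_connected_vertex(2)[OF wc v] well_connected_vertex(2)[OF wc u] assms(1)
    by (simp add: insert_commute)
  moreover have "{e \<in> edges G. vert G ` e \<inter> {v} \<noteq> {} \<and> vert G ` e \<inter> {u} \<noteq> {}} = ?P"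
    by (auto simp: incident_def)
  ultimately have "card ?P = k" using tight by simp
  moreover have "card (incident G v) = 2 * k"
    using cutsize_singleton[OF mg lf] well_connected_vertex(2)[OF wc v] by simp
  ultimately have cardQ: "card ?Q = k" using fin by (subst card_Diff_subset) auto
  have "good (2 * k) G v \<subseteq> cross_partitions ?P ?Q"
  proof
    fix \<tau> assume t: "\<tau> \<in> good (2 * k) G v"
    note tr = goodD(1)[OF t]
    have finc: "finite {p \<in> \<tau>. \<forall>e\<in>p. vert G ` e \<inter> S \<noteq> {}}" for S
      using finite_pairing(1)[OF mg transitions_pairing(1)[OF tr]] by simp
    have "{p \<in> \<tau>. \<forall>e\<in>p. vert G ` e \<inter> Y \<noteq> {}} = {}"
    proof -
      have "v \<notin> Y" using Y vX by simp
      from cutsize_resolve[OF mg lf tr this] goodD(4)[OF t order_refl]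
      have "card {p \<in> \<tau>. \<forall>e\<in>p. vert G ` e \<inter> Y \<noteq> {}} = 0" by linarith
      then show ?thesis using finc by (simp only: card_0_eq)
    qed
    moreover have "{p \<in> \<tau>. \<forall>e\<in>p. vert G ` e \<inter> {u} \<noteq> {}} = {}"
    proof -
      have "{u} \<subset> verts (resolve G v \<tau>)" using u assms(2) yY Y assms(1) by auto
      moreover have "conn (2 * k) (resolve G v \<tau>)" using t by (simp add: good_def)
      ultimately have "2 * k \<le> cutsize (resolve G v \<tau>) {u}" unfolding conn_def by blast
      moreover have "v \<notin> {u}" using assms(2) by simp
      note cutsize_resolve[OF mg lf tr this]
      ultimately have "card {p \<in> \<tau>. \<forall>e\<in>p. vert G ` e \<inter> {u} \<noteq> {}} = 0"
        using well_connected_vertex(2)[OF wc u] by linarith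
      then show ?thesis using finc by (simp only: card_0_eq)
    qed
    ultimately have noY: "\<exists>e\<in>p. vert G ` e \<inter> Y = {}" and nou: "\<exists>e\<in>p. vert G ` e \<inter> {u} = {}"
      if "p \<in> \<tau>" for p
      using that by blast+
    have meet: "vert G ` e \<inter> Y \<noteq> {} \<or> vert G ` e \<inter> {u} \<noteq> {}" if "e \<in> incident G v" for e
      using mg lf that by (rule incident_edge) (use XV Y assms(1) in auto)
    have "\<exists>a\<in>?P. \<exists>b\<in>?Q. p = {a, b}" if p: "p \<in> \<tau>" for p
    proof -
      have sub: "p \<subseteq> incident G v" and c: "card p = 2"
        using transitions_pairing[OF tr] p by (auto simp: pairing_def)
      obtain a where a: "a \<in> p" "vert G ` a \<inter> Y = {}" using noY[OF p] by blast
      obtain b where b: "b \<in> p" "vert G ` b \<inter> {u} = {}" using nou[OF p] by blast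
      have "a \<in> ?P" using a sub meet[of a] by auto
      moreover have "b \<in> ?Q" using b sub by auto
      moreover from calculation have "a \<noteq> b" by auto
      then have "p = {a, b}" using a(1) b(1) c by (auto simp: card_2_iff)
      ultimately show ?thesis by blast
    qed
    moreover have "partition_on (?P \<union> ?Q) \<tau>"
    proof -
      have "?P \<union> ?Q = incident G v" by auto
      then show ?thesis using tr by (simp add: transitions_def)
    qed
    ultimately show "\<tau> \<in> cross_partitions ?P ?Q" unfolding cross_partitions_def by blast
  qed
  moreover have "finite (cross_partitions ?P ?Q)"
    using finitely_many_partition_on[of "?P \<union> ?Q"] fin
    by (auto simp: cross_partitions_def intro: finite_subset[rotated])
  ultimately have "card (good (2 * k) G v) \<le> card (cross_partitions ?P ?Q)" by (intro card_mono)
  also have "\<dots> \<le> fact (card ?Q)" using fin by (intro card_cross_partitions) auto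
  finally show "card (good (2 * k) G v) \<le> fact k" using cardQ by simp
qed

text \<open>Without non-trivial tight cuts, a tight set obstructing a partner of \<open>e\<close> is
  a single vertex, so that partner is parallel to \<open>e\<close>. Fewer than k edges, counting
  \<open>e\<close>, join \<open>v\<close> to this vertex, which leaves at least k + 1 admissible
  partners.\<close>

lemma card_good_gt_fact:
  assumes "well_connected k G" "4 \<le> card (verts G)" "v \<in> verts G" "\<nexists>X Y. nontrivial_cut k G X Y"
  shows "fact k < card (good (2 * k) G v)"
proof -
  have mg: "multigraph G" using assms(1) by (simp add: well_connected_def)
  note fin = multigraph_finite(2)[OF mg]
  note lf = well_connected_vertex(1)[OF assms(1,3)]
  note spl = well_connected_splittable[OF assms(1,3)]
  have not_tight: "cutsize G S \<noteq> 2 * k" if "S \<subseteq> verts G" "2 \<le> card S" "2 \<le> card (verts G - S)" for S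
    using assms(4) that nontrivial_cut_iff[OF mg] by blast
  \<comment> \<open>Exactly k parallel edges would make \<open>{v, s}\<close> one side of a
    non-trivial tight cut, and more would violate connectivity.\<close>
  have mult: "card {e \<in> incident G v. vert G ` e \<inter> {s} \<noteq> {}} < k" if s: "s \<in> verts G" "s \<noteq> v" for s
  proof -
    have sv: "{v, s} \<subseteq> verts G" "card {v, s} = 2" using s assms(3) by auto
    then have c: "2 \<le> card (verts G - {v, s})" using assms(2)
      by (simp add: card_Diff_subset)
    then have "{v, s} \<subset> verts G" using sv(1) by force
    then have "2 * k \<le> cutsize G {v, s}" by (intro well_connected_conn[OF assms(1)]) auto
    moreover have "cutsize G {v, s} \<noteq> 2 * k" using sv c by (intro not_tight) auto
    moreover have "{v} \<inter> {s} = {}" using s by simp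
    from cutsize_Un_disjoint[OF mg this] have
      "4 * k = cutsize G {v, s} + 2 * card {e \<in> edges G. vert G ` e \<inter> {v} \<noteq> {} \<and> vert G ` e \<inter> {s} \<noteq> {}}"
      using well_connected_vertex(2)[OF assms(1)] s(1) assms(3) by (simp add: insert_commute)
    moreover have "{e \<in> edges G. vert G ` e \<inter> {v} \<noteq> {} \<and> vert G ` e \<inter> {s} \<noteq> {}} =
      {e \<in> incident G v. vert G ` e \<inter> {s} \<noteq> {}}"
      by (auto simp: incident_def)
    ultimately show ?thesis by simp
  qed
  have "verts G \<noteq> {v}" using assms(2) by auto
  then obtain w where "w \<in> verts G" "w \<noteq> v" using assms(3) by blast
  then have "0 < k" using mult[of w] by simp
  then obtain j where j: "k = Suc j" by (cases k) auto
  have inc: "card (incident G v) = 2 * k"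
    using cutsize_singleton[OF mg lf] well_connected_vertex(2)[OF assms(1,3)] by simp
  then obtain e where e: "e \<in> incident G v" using \<open>0 < k\<close> by (metis card.empty ex_in_conv mult_is_0 not_gr_zero zero_neq_numeral)
  obtain h h' where h: "e = {h, h'}" "vert G h = v" "vert G h' \<noteq> v" "vert G h' \<in> verts G"
    using incident_edge[OF mg lf e] by metis
  define s where "s = vert G h'"
  have s: "s \<in> verts G" "s \<noteq> v" "s \<in> vert G ` e" using h by (auto simp: s_def)
  let ?R = "{f \<in> incident G v. vert G ` f \<inter> {s} \<noteq> {}}"
  have "f \<in> ?R" if f: "f \<in> incident G v - {e}" "f \<notin> admissible (2 * k) G v e" for f
  proof -
    obtain S where S: "S \<subset> verts G - {v}" "vert G ` e \<inter> S \<noteq> {}" "vert G ` f \<inter> S \<noteq> {}"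
      "cutsize G S = 2 * k"
      using inadmissible_tight[OF spl _ e f] by auto
    have "s \<in> S" using S(1,2) h(1,2) by (auto simp: s_def)
    obtain w where w: "w \<in> verts G - {v}" "w \<notin> S" using S(1) by blast
    \<comment> \<open>\<open>v\<close> and \<open>w\<close> lie outside \<open>S\<close>, so it must
      be \<open>S\<close> that has fewer than two vertices.\<close>
    have "card {v, w} \<le> card (verts G - S)" using w S(1) assms(3) fin by (intro card_mono) auto
    moreover have "card {v, w} = 2" using w by auto
    moreover have "finite S" using S(1) fin by (auto intro: finite_subset)
    ultimately have "card S < 2" using not_tight[of S] S(1,4) by fastforce
    then have "card S = 1" using \<open>s \<in> S\<close> \<open>finite S\<close> by (cases "card S") auto
    then have "S = {s}" using \<open>s \<in> S\<close> by (auto simp: card_1_singleton_iff)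
    then show ?thesis using S(3) f(1) by auto
  qed
  then have "2 * k \<le> card (admissible (2 * k) G v e) + card ?R"
    using e s(3) by (intro card_admissible[OF spl e]) auto
  then have adm: "Suc k \<le> card (admissible (2 * k) G v e)" using mult[OF s(1,2)] by simp
  \<comment> \<open>With k = j + 1, the first edge contributes a factor k + 1 instead of k, and the
    remaining j pairs contribute at least \<open>fact j\<close>.\<close>
  have "fact k < Suc k * (fact j :: nat)" by (simp add: j)
  also have "\<dots> \<le> card (admissible (2 * k) G v e) * fact j" using adm by (rule mult_le_mono1)
  also have "\<dots> \<le> card (good (2 * k) G v)"
    using spl splittable_split_pair[OF _ e, of _ j] card_good_ge[of "2 * k" _ v j] unfolding j
    by (intro card_good_ge_admissible[OF _ e]) auto
  finally show ?thesis .
qed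

section \<open>Total decomposability in terms of transitions\<close>

text \<open>The equality condition for one step of the recursion: the number of surviving terms and
  each single term attain their lower bounds.\<close>

definition decomposes_after :: "nat \<Rightarrow> ('v, 'h) graph \<Rightarrow> 'v \<Rightarrow> bool" where
  "decomposes_after k G v \<longleftrightarrow> card (good (2 * k) G v) = fact k \<and> (\<forall>\<tau>\<in>good (2 * k) G v. decomposes k (resolve G v \<tau>))"

text \<open>
  Total decomposability refers to some decomposition; that it passes to the sides of every
  non-trivial tight cut is proved simultaneously with the characterization by transitions.
\<close>

definition sides_decompose :: "nat \<Rightarrow> ('v, 'h) graph \<Rightarrow> bool" where
  "sides_decompose k G \<longleftrightarrow> (decomposes k G \<longrightarrow> (\<forall>X Y x y. nontrivial_cut k G X Y \<longrightarrow> x \<in> X \<longrightarrow> y \<in> Y \<longrightarrow>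
     decomposes k (cut_side G X y) \<and> decomposes k (cut_side G Y x)))"

text \<open>The right-hand side depends on \<open>v\<close> but not on the cut, which is what
  carries decomposability from one cut to another. \<open>step\<close> and \<open>hered\<close> are
  the two halves of the induction hypothesis.\<close>

lemma (in tight_side) decomposes_sides_iff:
  assumes "2 \<le> card Y" "x \<in> X"
    and step: "\<And>(F :: ('v, 'h) graph) u. well_connected k F \<Longrightarrow> card (verts F) < card (verts G) \<Longrightarrow>
      4 \<le> card (verts F) \<Longrightarrow> u \<in> verts F \<Longrightarrow> decomposes k F \<longleftrightarrow> decomposes_after k F u"
    and hered: "\<And>F :: ('v, 'h) graph. well_connected k F \<Longrightarrow> card (verts F) < card (verts G) \<Longrightarrow>
      4 \<le> card (verts F) \<Longrightarrow> sides_decompose k F"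
  shows "decomposes k H \<and> decomposes k (cut_side G Y x) \<longleftrightarrow> decomposes_after k G v"
proof -
  have finV: "finite (verts G)" by (rule multigraph_finite[OF mg])
  then have fin: "finite X" using XV by (rule finite_subset[rotated])
  have cardV: "card (verts G) = card X + card Y"
    using Y XV fin finV by (simp add: card_Diff_subset card_mono)
  have cardH: "card (verts H) = Suc (card X)" using yX fin by simp
  show ?thesis
  proof (cases "card X = 2")
    \<comment> \<open>Here \<open>H\<close> has three vertices, too few for \<open>step\<close>; the
      number of good transitions and the resolved graphs are known directly.\<close>
    case True
    then obtain u where u: "X = {v, u}" "u \<noteq> v"
      using vX by (auto simp: card_2_iff)
    have "decomposes k H" using True cardH by (intro decomposes.three) simp
    then show ?thesis
      using decomposes_resolve_two[OF _ assms(2) u] card_good_two[OF u] good_ne by (auto simp: decomposes_after_def)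
  next
    case False
    then have X3: "3 \<le> card X" using X2 by simp
    have "decomposes k H \<longleftrightarrow> decomposes_after k H v"
      using X3 assms(1) cardH cardV vX by (intro step wcH) auto
    then have tdH: "decomposes k H \<longleftrightarrow> card (good (2 * k) G v) = fact k \<and> (\<forall>\<tau>\<in>good (2 * k) G v. decomposes k (resolve H v \<tau>))"
      by (simp add: decomposes_after_def good_H)
    obtain x' where x': "x' \<in> X'" using X'_ne by blast
    have "decomposes k (resolve G v \<tau>) \<longleftrightarrow> decomposes k (resolve H v \<tau>) \<and> decomposes k (cut_side G Y x)"
      if t: "\<tau> \<in> good (2 * k) G v" for \<tau>
    proof -
      note cut = nontrivial_cut_resolve[OF t X3 assms(1)]
      have wcR: "well_connected k (resolve G v \<tau>)"
        using cardV assms(1) X2 by (intro well_connected_resolve[OF wc v _ t]) simp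
      have "card (verts (resolve G v \<tau>)) < card (verts G)"
        using card_Diff1_less[OF finV v] by simp
      \<comment> \<open>The cut survives as \<open>X'\<close> and \<open>Y\<close>, but a
        decomposition of the resolved graph may start with another one; heredity bridges this
        gap.\<close>
      then have "sides_decompose k (resolve G v \<tau>)"
        using nontrivial_cut_card(1)[OF cut] by (intro hered[OF wcR])
      then have "decomposes k (resolve G v \<tau>) \<longleftrightarrow>
        decomposes k (cut_side (resolve G v \<tau>) X' y) \<and> decomposes k (cut_side (resolve G v \<tau>) Y x')"
        using cut x' yY decomposes.cut[OF cut x' yY] unfolding sides_decompose_def by blast
      then show ?thesis
        by (simp only: decomposes_side_X'[OF t] decomposes_side_Y[OF t assms(2) x'])
    qed
    then show ?thesis using tdH good_ne by (auto simp: decomposes_after_def)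
  qed
qed

text \<open>The halves need each other on smaller graphs: the equivalence is applied to the sides of
  a cut, heredity to the resolved graphs.\<close>

theorem decomposes_characterization:
  fixes G :: "('v, 'h) graph"
  assumes "well_connected k G" "4 \<le> card (verts G)"
  shows "(\<forall>v\<in>verts G. decomposes k G \<longleftrightarrow> decomposes_after k G v) \<and> sides_decompose k G"
  using assms
proof (induction "card (verts G)" arbitrary: G rule: less_induct)
  case less
  note wc = less.prems(1)
  have mg: "multigraph G" using wc by (simp add: well_connected_def)
  have side: "decomposes k (cut_side G X y) \<and> decomposes k (cut_side G Y x) \<longleftrightarrow> decomposes_after k G v"
    if cut: "nontrivial_cut k G X Y" and xy: "x \<in> X" "y \<in> Y" and v: "v \<in> X" for X Y x y v
  proof -
    have XY: "X \<subseteq> verts G" "Y = verts G - X" "2 \<le> card X" "2 \<le> card Y" "cutsize G X = 2 * k"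
      using cut by (auto simp: nontrivial_cut_iff[OF mg])
    interpret tight_side k G X Y v y
      by unfold_locales (use wc XY xy v in auto)
    show ?thesis
      using less.hyps by (intro decomposes_sides_iff[OF XY(4) xy(1)]) blast+
  qed
  have sides: "decomposes k (cut_side G X y) \<and> decomposes k (cut_side G Y x) \<longleftrightarrow> decomposes_after k G v"
    if cut: "nontrivial_cut k G X Y" and xy: "x \<in> X" "y \<in> Y" and v: "v \<in> verts G" for X Y x y v
  proof (cases "v \<in> X")
    case True
    then show ?thesis by (rule side[OF cut xy])
  next
    case False
    then have "v \<in> Y" using v cut by (auto simp: nontrivial_cut_def bipartition_def)
    then show ?thesis using side[OF nontrivial_cut_commute[OF mg cut] xy(2,1)] by blast
  qed
  have P: "decomposes k G \<longleftrightarrow> decomposes_after k G v" if v: "v \<in> verts G" for v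
  proof
    assume "decomposes k G"
    then show "decomposes_after k G v"
    proof cases
      case three
      then show ?thesis using less.prems(2) by simp
    next
      case (cut X Y x y)
      then show ?thesis using sides[OF cut(1-3) v] by blast
    qed
  next
    assume R: "decomposes_after k G v"
    \<comment> \<open>Without a non-trivial tight cut there would be more than \<open>fact k\<close>
      good transitions.\<close>
    then obtain X Y where cut: "nontrivial_cut k G X Y"
      using card_good_gt_fact[OF wc less.prems(2) v] by (auto simp: decomposes_after_def)
    then obtain x y where "x \<in> X" "y \<in> Y" by (auto simp: nontrivial_cut_def bipartition_def)
    then show "decomposes k G" using sides[OF cut _ _ v] R decomposes.cut[OF cut] by blast
  qed
  moreover have "sides_decompose k G"
    unfolding sides_decompose_def
  proof (intro impI allI)
    fix X Y x y
    assume *: "decomposes k G" "nontrivial_cut k G X Y" "x \<in> X" "y \<in> Y"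
    have "verts G \<noteq> {}" using less.prems(2) by auto
    \<comment> \<open>Any vertex links the cut behind \<open>decomposes k G\<close> to the given
      one.\<close>
    then obtain v where "v \<in> verts G" by blast
    then show "decomposes k (cut_side G X y) \<and> decomposes k (cut_side G Y x)"
      using P *(1) sides[OF *(2-4)] by blast
  qed
  ultimately show ?case by blast
qed

section \<open>The lower bound and its equality case\<close>

lemma martin_bound:
  fixes G :: "('v, 'h) graph"
  assumes "well_connected k G" "3 \<le> card (verts G)"
  shows "fact k ^ (card (verts G) - 3) \<le> martin G \<and>
    (martin G = fact k ^ (card (verts G) - 3) \<longleftrightarrow> decomposes k G)"
  using assms
proof (induction "card (verts G)" arbitrary: G rule: less_induct)
  case less
  note wc = less.prems(1)
  have mg: "multigraph G" and reg: "regular (2 * k) G" using wc by (auto simp: well_connected_def)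
  note nl = well_connected_no_loop[OF wc]
  show ?case
  proof (cases "card (verts G) = 3")
    case True
    then have "martin G = 1" using nl by (subst martin.simps) simp
    then show ?thesis using True by (simp add: decomposes.three)
  next
    case False
    then have 4: "4 \<le> card (verts G)" using less.prems(2) by simp
    obtain v where v: "v \<in> verts G" "martin G = (\<Sum>\<tau>\<in>transitions G v. martin (resolve G v \<tau>))"
      using martin_expand[OF nl 4] .
    note lf = well_connected_vertex(1)[OF wc v(1)]
    let ?A = "good (2 * k) G v"
    let ?m = "\<lambda>\<tau>. martin (resolve G v \<tau>)"
    \<comment> \<open>The bound for the resolved graphs, which have one vertex fewer.\<close>
    define a :: real where "a = fact k ^ (card (verts G) - 4)"
    have a0: "0 < a" by (simp add: a_def)
    have "card (verts G) - 3 = Suc (card (verts G) - 4)" using 4 by simp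
    then have fa: "fact k ^ (card (verts G) - 3) = fact k * a" by (simp add: a_def)
    have fin: "finite ?A" by (rule finite_good[OF mg])
    have "martin G = sum ?m ?A"
      unfolding v(2)
    proof (rule sum.mono_neutral_right)
      show "\<forall>\<tau>\<in>transitions G v - ?A. ?m \<tau> = 0"
      proof
        fix \<tau> assume "\<tau> \<in> transitions G v - ?A"
        then have t: "\<tau> \<in> transitions G v" "\<not> conn (2 * k) (resolve G v \<tau>)" by (auto simp: good_def)
        show "?m \<tau> = 0"
          using 4 v(1) by (intro martin_not_conn[OF multigraph_resolve[OF mg lf t(1)]
            regular_resolve[OF mg lf t(1) reg] _ t(2)]) simp
      qed
    qed (use finite_transitions[OF mg] in \<open>auto simp: good_def\<close>)
    \<comment> \<open>Separating the excess over \<open>a\<close> turns equality into two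
      independent conditions, one on the number of terms and one on every term.\<close>
    also have "\<dots> = card ?A * a + (\<Sum>\<tau>\<in>?A. ?m \<tau> - a)" by (simp add: sum_subtractf)
    finally have eq: "martin G = card ?A * a + (\<Sum>\<tau>\<in>?A. ?m \<tau> - a)" .
    have IH: "a \<le> ?m \<tau> \<and> (?m \<tau> = a \<longleftrightarrow> decomposes k (resolve G v \<tau>))" if t: "\<tau> \<in> ?A" for \<tau>
    proof -
      have "well_connected k (resolve G v \<tau>)"
        using less.prems(2) by (intro well_connected_resolve[OF wc v(1) _ t])
      moreover have "card (verts (resolve G v \<tau>)) = card (verts G) - 1" using v(1) by simp
      ultimately show ?thesis
        using less.hyps[of "resolve G v \<tau>"] 4 by (simp add: a_def)
    qed
    then have nn: "0 \<le> (\<Sum>\<tau>\<in>?A. ?m \<tau> - a)" by (intro sum_nonneg) simp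
    have "real (fact k) \<le> real (card ?A)"
      unfolding of_nat_le_iff by (rule fact_le_card_good[OF wc v(1)])
    then have ca: "fact k * a \<le> card ?A * a"
      using a0 by (intro mult_right_mono) simp_all
    have "real (card ?A) = real (fact k) \<longleftrightarrow> card ?A = fact k"
      by (rule of_nat_eq_iff)
    then have ca': "card ?A * a = fact k * a \<longleftrightarrow> card ?A = fact k"
      using a0 by simp
    have "martin G = fact k * a \<longleftrightarrow> card ?A * a = fact k * a \<and> (\<Sum>\<tau>\<in>?A. ?m \<tau> - a) = 0"
      using eq nn ca by linarith
    also have "(\<Sum>\<tau>\<in>?A. ?m \<tau> - a) = 0 \<longleftrightarrow> (\<forall>\<tau>\<in>?A. ?m \<tau> - a = 0)"
      using IH fin by (intro sum_nonneg_eq_0_iff) auto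
    also have "card ?A * a = fact k * a \<and> (\<forall>\<tau>\<in>?A. ?m \<tau> - a = 0) \<longleftrightarrow> decomposes_after k G v"
      unfolding ca' decomposes_after_def using IH by simp
    also have "\<dots> \<longleftrightarrow> decomposes k G" using decomposes_characterization[OF wc 4] v(1) by blast
    finally show ?thesis using eq nn ca unfolding fa by simp
  qed
qed

text \<open>The power is an integer power because the exponent is -1 for two vertices.\<close>

theorem theorem3p5:
  fixes G :: "('v, 'h) graph" and k n :: nat
  assumes "multigraph G"
    and "regular (2 * k) G"
    and "edge_connected (2 * k) G"
    and "card (verts G) = n"
    and "n \<ge> 2"
  shows "martin G \<ge> (fact k :: real) powi (int n - 3) \<and>
    (martin G = (fact k :: real) powi (int n - 3) \<longleftrightarrow> totally_decomposable k G)"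
proof -
  have wc: "well_connected k G"
    using assms edge_connected_iff_conn[OF assms(1)] by (simp add: well_connected_def)
  note nl = well_connected_no_loop[OF wc]
  show ?thesis
  proof (cases "n = 2")
    \<comment> \<open>All 2k edges join the two vertices, so the value \<open>1 / fact k\<close>
      equals the bound, in accordance with the convention that this graph is totally
      decomposable.\<close>
    case True
    then obtain u w where uw: "verts G = {u, w}" "u \<noteq> w" using assms(4) by (auto simp: card_2_iff)
    have "e \<in> incident G u" if e: "e \<in> edges G" for e
      using assms(1) e
    proof (rule multigraph_edge)
      fix h h' assume h: "e = {h, h'}" "vert G h \<in> verts G" "vert G h' \<in> verts G"
      have "vert G ` e \<noteq> {w}" using nl e by (auto simp: has_self_loop_def)
      then show ?thesis using h e uw by (auto simp: incident_def)
    qed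
    then have "edges G = incident G u" by (auto simp: incident_def)
    then have "card (edges G) = 2 * k"
      using cutsize_singleton[OF assms(1)] well_connected_vertex[OF wc, of u] uw(1) by simp
    then have "martin G = 1 / fact k"
      using nl True assms(4) by (subst martin.simps) simp
    then show ?thesis
      using True assms(4) by (simp add: totally_decomposable_def power_int_minus field_simps)
  next
    case False
    then have n: "3 \<le> card (verts G)" using assms(4,5) by simp
    have "int n - 3 = int (card (verts G) - 3)" using n assms(4) by simp
    then have "(fact k :: real) powi (int n - 3) = fact k ^ (card (verts G) - 3)"
      by (simp only: power_int_of_nat)
    moreover have "totally_decomposable k G \<longleftrightarrow> decomposes k G"
      using n by (simp add: totally_decomposable_def decomposes_iff_decomposition)
    ultimately show ?thesis using martin_bound[OF wc n] by simp
  qed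
qed

end
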